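(* Let $M$ be a monoid, $X\subset M$ a nonempty subset, and let $\mathcal{F}=\mathcal{F}(M,X)$ be the family of languages determined by $M$ and $X$. Then $\mathcal{F}$ contains all rational languages and is closed under rational transduction and union. Conversely, every collection of languages which contains a nonempty language and is closed under rational transduction and union is a family of languages, i.e. is equal to $\mathcal{F}(M,X)$ for some monoid $M$ and some nonempty subset $X\subset M$.
   Context: Alphabets $\Sigma,\Delta$ are nonempty finite sets; $\Sigma^*$ is the free monoid over $\Sigma$, and a language over $\Sigma$ is a subset of $\Sigma^*$. The rational subsets of a monoid $N$ are the members of the smallest collection of subsets of $N$ containing all finite subsets and closed under union $S_1\cup S_2$, product $S_1S_2$, and generation of submonoid $S\mapsto S^*$. A rational language is a rational subset of some $\Sigma^*$. A relation $\rho: N\to N'$ between monoids is identified with its graph, a subset of $N\times N'$; it is rational if it is a rational subset of the monoid $N\times N'$. For $S\subset N$, the image is $S\rho=\{n' \in N' \mid (s,n')\in\rho \text{ for some } s\in S\}$. A rational transduction is a rational relation $\Sigma^*\to\Delta^*$ between finitely generated free monoids. For a monoid $M$ and a nonempty subset $X\subset M$, the family of languages $\mathcal{F}(M,X)$ is the collection of all images $X\rho$ as $\rho$ ranges over all rational relations from $M$ to finitely generated free monoids $\Sigma^*$. A family of languages is a collection of the form $\mathcal{F}(M,X)$. A collection of languages is closed under rational transduction if, whenever it contains a language $L\subset\Sigma^*$ and $\tau:\Sigma^*\to\Delta^*$ is a rational transduction, it contains $L\tau$. It is closed under union if whenever it contains languages $L$ and $L'$ over the same alphabet it contains $L\cup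 L'$. *)

theory Defs
  imports "HOL-Algebra.Group" "HOL-Algebra.Coset" "HOL.Hull"
begin

inductive rational :: "('n, 'e) monoid_scheme \<Rightarrow> 'n set \<Rightarrow> bool"
  for N :: "('n, 'e) monoid_scheme" where
  finite: "finite S \<Longrightarrow> S \<subseteq> carrier N \<Longrightarrow> rational N S"
| union: "rational N S \<Longrightarrow> rational N T \<Longrightarrow> rational N (S \<union> T)"
| product: "rational N S \<Longrightarrow> rational N T \<Longrightarrow> rational N (S <#>\<^bsub>N\<^esub> T)"
| star: "rational N S \<Longrightarrow> rational N ((\<lambda>H. submonoid H N) hull S)"

text \<open>Alphabets are the nonempty finite sets of elements of a type of letters, which is left
  arbitrary. Languages are plain sets of words: one and the same set of words counts as a language
  over every alphabet containing all the letters that occur in it.\<close>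

definition alphabet :: "'a set \<Rightarrow> bool" where
  "alphabet \<Sigma> \<longleftrightarrow> finite \<Sigma> \<and> \<Sigma> \<noteq> {}"

definition free_monoid :: "'a set \<Rightarrow> 'a list monoid" where
  "free_monoid \<Sigma> = \<lparr>carrier = lists \<Sigma>, mult = (@), one = []\<rparr>"

definition language_over :: "'a set \<Rightarrow> 'a list set \<Rightarrow> bool" where
  "language_over \<Sigma> L \<longleftrightarrow> L \<subseteq> carrier (free_monoid \<Sigma>)"

definition rational_language :: "'a list set \<Rightarrow> bool" where
  "rational_language L \<longleftrightarrow> (\<exists>\<Sigma>. alphabet \<Sigma> \<and> rational (free_monoid \<Sigma>) L)"

definition rational_relation ::
  "('m, 'e) monoid_scheme \<Rightarrow> ('n, 'f) monoid_scheme \<Rightarrow> ('m \<times> 'n) set \<Rightarrow> bool" where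
  "rational_relation N N' \<rho> \<longleftrightarrow> rational (N \<times>\<times> N') \<rho>"

definition language_family :: "('m, 'e) monoid_scheme \<Rightarrow> 'm set \<Rightarrow> 'a list set set" where
  "language_family M X =
     {\<rho> `` X | \<rho> \<Sigma>. alphabet \<Sigma> \<and> rational_relation M (free_monoid \<Sigma>) \<rho>}"

definition collection_of_languages :: "'a list set set \<Rightarrow> bool" where
  "collection_of_languages C \<longleftrightarrow> (\<forall>L\<in>C. \<exists>\<Sigma>. alphabet \<Sigma> \<and> language_over \<Sigma> L)"

definition closed_under_rational_transduction :: "'a list set set \<Rightarrow> bool" where
  "closed_under_rational_transduction C \<longleftrightarrow>
     (\<forall>\<Sigma> \<Delta> L \<tau>. alphabet \<Sigma> \<and> alphabet \<Delta> \<and> L \<in> C \<and> language_over \<Sigma> L \<and>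
        rational_relation (free_monoid \<Sigma>) (free_monoid \<Delta>) \<tau> \<longrightarrow> \<tau> `` L \<in> C)"

definition closed_under_union :: "'a list set set \<Rightarrow> bool" where
  "closed_under_union C \<longleftrightarrow>
     (\<forall>\<Sigma> L L'. alphabet \<Sigma> \<and> L \<in> C \<and> L' \<in> C \<and> language_over \<Sigma> L \<and> language_over \<Sigma> L' \<longrightarrow>
        L \<union> L' \<in> C)"

end

theory Submission
  imports Defs
begin

text \<open>Closure of \<open>\<F>(M, X)\<close> under transduction amounts to composing a rational relation
  \<open>\<rho> \<subseteq> M \<times> \<Sigma>\<^sup>*\<close> with a rational relation \<open>\<tau> \<subseteq> \<Sigma>\<^sup>* \<times> \<Delta>\<^sup>*\<close>. Realize \<open>\<rho>\<close> by a finite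
  automaton whose edges read at most one letter. For states \<open>p\<close>, \<open>q\<close> let \<open>\<tau>\<^bsub>pq\<^esub>\<close> consist of the
  pairs \<open>(m, v)\<close> for which some run from \<open>p\<close> to \<open>q\<close> has a label \<open>(m, u)\<close> with \<open>(u, v) \<in> \<tau>\<close>. Since
  runs split wherever their words do, \<open>\<tau>\<^bsub>pq\<^esub>\<close> is rational by induction on \<open>\<tau>\<close>; the star case is
  Kleene's theorem for automata whose edges are labelled with rational sets.

  Conversely, given a closed collection \<open>C\<close>, let \<open>X\<close> be the disjoint union of the languages in \<open>C\<close>
  over a free monoid on tagged letters. A rational relation on this monoid involves only finitely
  many letters, so \<open>X\<rho>\<close> is a finite union of transduced members of \<open>C\<close>.\<close>

section \<open>Rational subsets of monoids\<close>

text \<open>For \<open>S\<close> inside the carrier this is the generated submonoid. Splitting one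
  factor off on the left gives the induction used in all star cases.\<close>

inductive_set mon_star :: "('n, 'e) monoid_scheme \<Rightarrow> 'n set \<Rightarrow> 'n set"
  for N :: "('n, 'e) monoid_scheme" and S :: "'n set" where
  one: "\<one>\<^bsub>N\<^esub> \<in> mon_star N S"
| mult: "a \<in> S \<Longrightarrow> s \<in> mon_star N S \<Longrightarrow> a \<otimes>\<^bsub>N\<^esub> s \<in> mon_star N S"

lemma mem_set_mult:
  "x \<in> S <#>\<^bsub>N\<^esub> T \<longleftrightarrow> (\<exists>a\<in>S. \<exists>b\<in>T. x = a \<otimes>\<^bsub>N\<^esub> b)"
  by (auto simp: set_mult_def)

lemma set_multI: "a \<in> S \<Longrightarrow> b \<in> T \<Longrightarrow> a \<otimes>\<^bsub>N\<^esub> b \<in> S <#>\<^bsub>N\<^esub> T"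
  by (auto simp: set_mult_def)

context monoid
begin

lemma mon_star_closed: "s \<in> mon_star G S \<Longrightarrow> S \<subseteq> carrier G \<Longrightarrow> s \<in> carrier G"
  by (induction rule: mon_star.induct) auto

lemma mon_star_base: "S \<subseteq> carrier G \<Longrightarrow> a \<in> S \<Longrightarrow> a \<in> mon_star G S"
  using mon_star.mult[of a S \<one> G] mon_star.one[of G S] by auto

lemma mon_star_append:
  assumes "S \<subseteq> carrier G" "s \<in> mon_star G S" "t \<in> mon_star G S"
  shows "s \<otimes> t \<in> mon_star G S"
  using assms(2)
proof induction
  case one
  then show ?case using assms mon_star_closed by auto
next
  case (mult a s)
  then have "a \<otimes> s \<otimes> t = a \<otimes> (s \<otimes> t)"
    using assms mon_star_closed m_assoc by blast
  then show ?case using mult by (simp add: mon_star.mult)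
qed

lemma hull_eq_mon_star:
  assumes "S \<subseteq> carrier G"
  shows "(\<lambda>H. submonoid H G) hull S = mon_star G S"
proof
  have "submonoid (mon_star G S) G"
    using assms mon_star_closed mon_star_append by (auto intro!: submonoid.intro mon_star.one)
  then show "(\<lambda>H. submonoid H G) hull S \<subseteq> mon_star G S"
    using assms by (intro hull_minimal) (auto simp: mon_star_base)
  show "mon_star G S \<subseteq> (\<lambda>H. submonoid H G) hull S"
  proof
    fix x assume "x \<in> mon_star G S"
    then show "x \<in> (\<lambda>H. submonoid H G) hull S"
      by induction (auto simp: hull_def submonoid.one_closed intro!: submonoid.m_closed)
  qed
qed

lemma rational_carrier: "rational G S \<Longrightarrow> S \<subseteq> carrier G"
proof (induction rule: rational.induct)
  case (product S T)
  then show ?case by (fastforce simp: mem_set_mult)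
next
  case (star S)
  then show ?case using hull_eq_mon_star mon_star_closed by auto
qed auto

lemma rational_star: "rational G S \<Longrightarrow> rational G (mon_star G S)"
  using rational.star[of G S] hull_eq_mon_star rational_carrier by simp

text \<open>Carrier facts are added to the cases, and the hull is replaced by
  \<open>mon_star\<close>, so that star cases can argue about products of elements of
  \<open>S\<close>.\<close>

lemma rational_mon_induct [consumes 1, case_names finite union product star]:
  assumes "rational G S"
    and "\<And>S. finite S \<Longrightarrow> S \<subseteq> carrier G \<Longrightarrow> P S"
    and "\<And>S T. S \<subseteq> carrier G \<Longrightarrow> T \<subseteq> carrier G \<Longrightarrow> P S \<Longrightarrow> P T \<Longrightarrow> P (S \<union> T)"
    and "\<And>S T. S \<subseteq> carrier G \<Longrightarrow> T \<subseteq> carrier G \<Longrightarrow> P S \<Longrightarrow> P T \<Longrightarrow> P (S <#> T)"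
    and "\<And>S. S \<subseteq> carrier G \<Longrightarrow> P S \<Longrightarrow> P (mon_star G S)"
  shows "P S"
  using assms(1)
proof (induction rule: rational.induct)
  case (union S T)
  then show ?case by (intro assms(3) rational_carrier)
next
  case (product S T)
  then show ?case by (intro assms(4) rational_carrier)
next
  case (star S)
  then show ?case using assms(5)[of S] by (simp add: hull_eq_mon_star rational_carrier)
qed (rule assms(2))

end

lemma rational_UN:
  "finite I \<Longrightarrow> (\<And>i. i \<in> I \<Longrightarrow> rational N (S i)) \<Longrightarrow> rational N (\<Union>i\<in>I. S i)"
proof (induction rule: finite_induct)
  case empty
  then show ?case by (simp add: rational.finite)
next
  case (insert i I)
  then show ?case by (auto intro: rational.union)
qed

text \<open>Homomorphisms commute with union, product and star. Since \<open>hom\<close> demands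
  only multiplicativity, preservation of the unit is assumed separately; the empty product in a star
  uses it.\<close>

lemma rational_image:
  assumes "monoid N" "monoid N'" "h \<in> hom N N'" "h \<one>\<^bsub>N\<^esub> = \<one>\<^bsub>N'\<^esub>" "rational N S"
  shows "rational N' (h ` S)"
proof -
  interpret N: monoid N by fact
  interpret N': monoid N' by fact
  have hm: "h (a \<otimes>\<^bsub>N\<^esub> b) = h a \<otimes>\<^bsub>N'\<^esub> h b" if "a \<in> carrier N" "b \<in> carrier N" for a b
    using assms(3) that by (simp add: hom_def)
  from assms(5) show ?thesis
  proof (induction rule: N.rational_mon_induct)
    case (finite S)
    then show ?case using assms(3) by (auto intro!: rational.finite simp: hom_def)
  next
    case (union S T)
    then show ?case by (simp add: image_Un rational.union)
  next
    case (product S T)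
    have "h ` (S <#>\<^bsub>N\<^esub> T) = (h ` S) <#>\<^bsub>N'\<^esub> (h ` T)"
    proof (intro equalityI subsetI)
      fix y assume "y \<in> h ` (S <#>\<^bsub>N\<^esub> T)"
      then obtain a b where "a \<in> S" "b \<in> T" "y = h (a \<otimes>\<^bsub>N\<^esub> b)" by (auto simp: mem_set_mult)
      then show "y \<in> (h ` S) <#>\<^bsub>N'\<^esub> (h ` T)"
        using hm[of a b] product by (auto simp: mem_set_mult)
    next
      fix y assume "y \<in> (h ` S) <#>\<^bsub>N'\<^esub> (h ` T)"
      then obtain a b where ab: "a \<in> S" "b \<in> T" "y = h a \<otimes>\<^bsub>N'\<^esub> h b"
        by (auto simp: mem_set_mult)
      then have "y = h (a \<otimes>\<^bsub>N\<^esub> b)" using hm product(1,2) by (metis subsetD)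
      moreover have "a \<otimes>\<^bsub>N\<^esub> b \<in> S <#>\<^bsub>N\<^esub> T" using ab by (auto simp: mem_set_mult)
      ultimately show "y \<in> h ` (S <#>\<^bsub>N\<^esub> T)" by simp
    qed
    then show ?case using product by (simp add: rational.product)
  next
    case (star S)
    have "h ` mon_star N S = mon_star N' (h ` S)"
    proof (intro equalityI subsetI)
      fix y assume "y \<in> h ` mon_star N S"
      then obtain x where "x \<in> mon_star N S" "y = h x" by auto
      moreover have "x \<in> mon_star N S \<Longrightarrow> h x \<in> mon_star N' (h ` S)" for x
      proof (induction rule: mon_star.induct)
        case (mult a s)
        then have "h (a \<otimes>\<^bsub>N\<^esub> s) = h a \<otimes>\<^bsub>N'\<^esub> h s"
          using star N.mon_star_closed hm by blast
        then show ?case using mult by (simp add: mon_star.mult)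
      qed (simp add: assms mon_star.one)
      ultimately show "y \<in> mon_star N' (h ` S)" by simp
    next
      fix y assume "y \<in> mon_star N' (h ` S)"
      then show "y \<in> h ` mon_star N S"
      proof induction
        case one
        then show ?case by (metis assms(4) image_eqI mon_star.one)
      next
        case (mult b t)
        then obtain a s where "a \<in> S" "s \<in> mon_star N S" "b = h a" "t = h s" by auto
        moreover from this have "h (a \<otimes>\<^bsub>N\<^esub> s) = b \<otimes>\<^bsub>N'\<^esub> t"
          using star N.mon_star_closed hm by blast
        ultimately show ?case by (metis image_eqI mon_star.mult)
      qed
    qed
    then show ?case using star N'.rational_star by simp
  qed
qed

section \<open>Kleene's theorem\<close>

text \<open>Labels are arbitrary elements of the monoid and \<open>E\<close> may be infinite, so an
  edge labelled with a set is represented by one edge for each element of that set.\<close>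

inductive path :: "('n, 'e) monoid_scheme \<Rightarrow> ('s \<times> 'n \<times> 's) set \<Rightarrow> 's \<Rightarrow> 'n \<Rightarrow> 's \<Rightarrow> bool"
  for N :: "('n, 'e) monoid_scheme" and E :: "('s \<times> 'n \<times> 's) set" where
  refl: "path N E p \<one>\<^bsub>N\<^esub> p"
| step: "(p, a, r) \<in> E \<Longrightarrow> path N E r n q \<Longrightarrow> path N E p (a \<otimes>\<^bsub>N\<^esub> n) q"

lemma path_map:
  assumes "path N E p n q" "\<And>p a q. (p, a, q) \<in> E \<Longrightarrow> (c p, a, c q) \<in> E'"
  shows "path N E' (c p) n (c q)"
  using assms(1) by induction (auto intro: path.intros assms(2))

context monoid
begin

lemma path_closed:
  assumes "path G E p n q" "E \<subseteq> UNIV \<times> carrier G \<times> UNIV"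
  shows "n \<in> carrier G"
  using assms by induction auto

lemma path_edge:
  "(p, a, q) \<in> E \<Longrightarrow> a \<in> carrier G \<Longrightarrow> path G E p a q"
  using path.step[of p a q E G \<one> q] path.refl[of G E q] by simp

lemma path_trans:
  assumes "path G E p m r" "path G E r n q" "E \<subseteq> UNIV \<times> carrier G \<times> UNIV"
  shows "path G E p (m \<otimes> n) q"
  using assms
proof induction
  case (refl p)
  then show ?case using path_closed[of E p n q] by simp
next
  case (step p a r m q')
  then have "a \<in> carrier G" "m \<in> carrier G" "n \<in> carrier G"
    using path_closed[of E] by auto
  then show ?case using step path.step[of p a r E G "m \<otimes> n" q] by (simp add: m_assoc)
qed

end

text \<open>The McNaughton--Yamada construction: paths of length at least one whose intermediate states lie
  in \<open>K\<close>.\<close>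

inductive path_via :: "('n, 'e) monoid_scheme \<Rightarrow> ('s \<times> 'n \<times> 's) set \<Rightarrow> 's set \<Rightarrow> 's \<Rightarrow> 'n \<Rightarrow> 's \<Rightarrow> bool"
  for N :: "('n, 'e) monoid_scheme" and E :: "('s \<times> 'n \<times> 's) set" and K :: "'s set" where
  edge: "(p, a, q) \<in> E \<Longrightarrow> path_via N E K p a q"
| step: "(p, a, r) \<in> E \<Longrightarrow> r \<in> K \<Longrightarrow> path_via N E K r n q \<Longrightarrow> path_via N E K p (a \<otimes>\<^bsub>N\<^esub> n) q"

lemma path_via_mono:
  "path_via N E K p n q \<Longrightarrow> K \<subseteq> K' \<Longrightarrow> path_via N E K' p n q"
  by (induction rule: path_via.induct) (auto intro: path_via.intros)

context monoid
begin

lemma path_via_closed: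
  assumes "path_via G E K p n q" "E \<subseteq> UNIV \<times> carrier G \<times> UNIV"
  shows "n \<in> carrier G"
  using assms by induction auto

lemma path_via_trans:
  assumes "path_via G E K p m r" "r \<in> K" "path_via G E K r n q" "E \<subseteq> UNIV \<times> carrier G \<times> UNIV"
  shows "path_via G E K p (m \<otimes> n) q"
  using assms
proof induction
  case (edge p a r)
  then show ?case by (auto intro: path_via.step)
next
  case (step p a s m r)
  then have "a \<in> carrier G" "m \<in> carrier G" "n \<in> carrier G"
    using path_via_closed[of E K] by auto
  then show ?case using step path_via.step[of p a s E K G "m \<otimes> n" q] by (simp add: m_assoc)
qed

text \<open>A path that uses \<open>k\<close> as an intermediate state is cut at its visits to
  \<open>k\<close>: the pieces between the first and the last visit are loops at \<open>k\<close>
  and form the starred factor, and inside every piece the intermediate states lie in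
  \<open>K\<close>.\<close>

lemma path_via_insert:
  assumes E: "E \<subseteq> UNIV \<times> carrier G \<times> UNIV"
  shows "{n. path_via G E (insert k K) p n q} =
    {n. path_via G E K p n q} \<union>
    ({n. path_via G E K p n k} <#> mon_star G {n. path_via G E K k n k} <#> {n. path_via G E K k n q})"
proof -
  define L where "L p q = {n. path_via G E (insert k K) p n q}" for p q
  define R where "R p q = {n. path_via G E K p n q} \<union>
    ({n. path_via G E K p n k} <#> mon_star G {n. path_via G E K k n k} <#> {n. path_via G E K k n q})"
    for p q
  have star_closed: "s \<in> carrier G" if "s \<in> mon_star G {n. path_via G E K k n k}" for s
    using that E path_via_closed by (intro mon_star_closed) auto
  note closed = path_via_closed[OF _ E] star_closed
  have RI: "a \<otimes> s \<otimes> b \<in> R p q"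
    if "path_via G E K p a k" "s \<in> mon_star G {n. path_via G E K k n k}" "path_via G E K k b q"
    for a s b p q
    using that unfolding R_def by (intro UnI2 set_multI) auto
  have "L p q \<subseteq> R p q"
  proof
    fix n assume "n \<in> L p q"
    then have "path_via G E (insert k K) p n q" by (simp add: L_def)
    then show "n \<in> R p q"
    proof induction
      case (edge p a q)
      then show ?case by (auto simp: R_def intro: path_via.edge)
    next
      case (step p a r n q)
      then have a: "a \<in> carrier G" using E by auto
      have *: "path_via G E K p (a \<otimes> c) t" if "path_via G E K r c t" "r \<in> K" for c t
        using step that by (auto intro: path_via.step)
      have **: "path_via G E K p a r" using step by (auto intro: path_via.edge)
      from step.IH consider (direct) "path_via G E K r n q"
        | (through) b s c where "path_via G E K r b k" "s \<in> mon_star G {n. path_via G E K k n k}"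
          "path_via G E K k c q" "n = b \<otimes> s \<otimes> c"
        by (auto simp: mem_set_mult R_def)
      then show ?case
      proof cases
        case direct
        show ?thesis
        proof (cases "r \<in> K")
          case True
          then show ?thesis using * direct by (simp add: R_def)
        next
          case False
          \<comment> \<open>The first edge already reaches \<open>k\<close>, so the starred factor
            is the empty product.\<close>
          then have "r = k" using step by auto
          then show ?thesis
            using RI[of p a \<one> n q] ** direct closed(1) a by (auto simp: mon_star.one)
        qed
      next
        case through
        note cl = closed(1)[OF through(1)] closed(1)[OF through(3)] closed(2)[OF through(2)]
        show ?thesis
        proof (cases "r \<in> K")
          case True
          then show ?thesis
            using RI[of p "a \<otimes> b" s c q] * through cl a by (simp add: m_assoc)
        next
          case False
          \<comment> \<open>Here \<open>b\<close> is a loop at \<open>k\<close> and becomes one more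
            factor of the star.\<close>
          then have "r = k" using step by auto
          then show ?thesis
            using RI[of p a "b \<otimes> s" c q] ** through cl a by (simp add: m_assoc mon_star.mult)
        qed
      qed
    qed
  qed
  moreover have "R p q \<subseteq> L p q"
  proof
    fix n assume "n \<in> R p q"
    then consider (direct) "path_via G E K p n q"
        | (through) b s c where "path_via G E K p b k" "s \<in> mon_star G {n. path_via G E K k n k}"
          "path_via G E K k c q" "n = b \<otimes> s \<otimes> c"
        by (auto simp: mem_set_mult R_def)
    then show "n \<in> L p q"
    proof cases
      case direct
      then show ?thesis by (auto simp: L_def intro: path_via_mono)
    next
      case through
      \<comment> \<open>The loops are attached to \<open>c\<close> one by one on the left; joining
        at \<open>k\<close> is legitimate because \<open>k\<close> is now an allowed intermediate
        state.\<close>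
      have "path_via G E (insert k K) k (s \<otimes> c) q"
        using through(2)
      proof induction
        case one
        then show ?case using through closed(1) by (auto intro: path_via_mono)
      next
        case (mult a s)
        then have "path_via G E (insert k K) k a k" by (auto intro: path_via_mono)
        then have "path_via G E (insert k K) k (a \<otimes> (s \<otimes> c)) q"
          using mult E by (intro path_via_trans[of E _ k a k]) auto
        moreover have "a \<in> carrier G" "s \<in> carrier G" "c \<in> carrier G"
          using mult through closed by auto
        ultimately show ?case by (simp add: m_assoc)
      qed
      moreover have "path_via G E (insert k K) p b k"
        using through by (auto intro: path_via_mono)
      ultimately have "path_via G E (insert k K) p (b \<otimes> (s \<otimes> c)) q"
        using E by (intro path_via_trans[of E _ p b k]) auto
      then show ?thesis using through closed by (simp add: L_def m_assoc)
    qed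
  qed
  ultimately have "L p q = R p q" by (rule equalityI)
  then show ?thesis by (simp only: L_def R_def)
qed

text \<open>With no intermediate states only single edges remain; admitting one further state costs
  a union, two products and a star.\<close>

lemma rational_path_via:
  assumes "finite K" and E: "E \<subseteq> UNIV \<times> carrier G \<times> UNIV"
    and "\<And>p q. rational G {a. (p, a, q) \<in> E}"
  shows "rational G {n. path_via G E K p n q}"
  using assms(1)
proof (induction K arbitrary: p q rule: finite_induct)
  case empty
  have "{n. path_via G E {} p n q} = {a. (p, a, q) \<in> E}"
    by (auto intro: path_via.intros elim: path_via.cases)
  then show ?case using assms by simp
next
  case (insert k K)
  then show ?case
    unfolding path_via_insert[OF E] by (intro rational.union rational.product rational_star)
qed

text \<open>Kleene's theorem from automata to rational sets, with whole rational sets of labels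
  between two states; the star case of composition requires this generality. Every edge ends in
  \<open>Q\<close>, so \<open>Q\<close> can serve as the set of allowed intermediate states.\<close>

theorem rational_path:
  assumes "finite Q" and E: "E \<subseteq> Q \<times> carrier G \<times> Q"
    and "\<And>p q. p \<in> Q \<Longrightarrow> q \<in> Q \<Longrightarrow> rational G {a. (p, a, q) \<in> E}"
  shows "rational G {n. path G E p n q}"
proof -
  have E': "E \<subseteq> UNIV \<times> carrier G \<times> UNIV" using E by auto
  have rat: "rational G {a. (p, a, q) \<in> E}" for p q
  proof (cases "p \<in> Q \<and> q \<in> Q")
    case False
    then have "{a. (p, a, q) \<in> E} = {}" using E by auto
    then show ?thesis by (simp add: rational.finite)
  qed (use assms in auto)
  have "path G E p n q \<Longrightarrow> n = \<one> \<and> p = q \<or> path_via G E Q p n q" for n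
  proof (induction rule: path.induct)
    case (step p a r n q)
    then have "a \<in> carrier G" "r \<in> Q" using E by auto
    then show ?case using step by (auto intro: path_via.intros)
  qed auto
  moreover have "path_via G E Q p n q \<Longrightarrow> path G E p n q" for n
  proof (induction rule: path_via.induct)
    case (edge p a q)
    then show ?case using path_edge[of p a q] E by auto
  qed (auto intro: path.step)
  \<comment> \<open>\<open>path_via\<close> counts only paths with at least one edge; the empty path
    contributes the unit when its two ends agree.\<close>
  ultimately have "{n. path G E p n q} =
      (if p = q then {\<one>} else {}) \<union> {n. path_via G E Q p n q}"
    by (auto intro: path.refl)
  also have "rational G \<dots>"
    by (intro rational.union rational_path_via rat E' assms(1)) (auto intro: rational.finite)
  finally show ?thesis .
qed

end


text \<open>States are bit strings because these leave room for disjoint copies of two automata.\<close>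

definition recognizable ::
  "('n, 'e) monoid_scheme \<Rightarrow> 'n set \<Rightarrow> 'n set \<Rightarrow> bool" where
  "recognizable N B S \<longleftrightarrow> (\<exists>(E :: (bool list \<times> 'n \<times> bool list) set) I F.
     finite E \<and> finite I \<and> finite F \<and> E \<subseteq> UNIV \<times> B \<times> UNIV \<and>
     S = {n. \<exists>i\<in>I. \<exists>f\<in>F. path N E i n f})"

definition copy :: "bool \<Rightarrow> (bool list \<times> 'n \<times> bool list) set \<Rightarrow> (bool list \<times> 'n \<times> bool list) set" where
  "copy b E = (\<lambda>(p, a, q). (b # p, a, b # q)) ` E"

lemma mem_copy:
  "(p, a, q) \<in> copy b E \<longleftrightarrow> (\<exists>p' q'. p = b # p' \<and> q = b # q' \<and> (p', a, q') \<in> E)"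
  by (force simp: copy_def)

section \<open>From rational sets to finite automata\<close>

lemma recognizable_empty: "recognizable N B {}"
  unfolding recognizable_def by (rule exI[of _ "{}"], rule exI[of _ "{}"]) auto

text \<open>The two automata are placed side by side on disjoint copies of their states. Every edge
  preserves the leading bit, so a path never leaves its copy.\<close>

lemma recognizable_union:
  assumes "recognizable N B S" "recognizable N B T"
  shows "recognizable N B (S \<union> T)"
proof -
  obtain E1 :: "(bool list \<times> 'a \<times> bool list) set" and I1 F1 where
    1: "finite E1" "finite I1" "finite F1" "E1 \<subseteq> UNIV \<times> B \<times> UNIV"
      "S = {n. \<exists>i\<in>I1. \<exists>f\<in>F1. path N E1 i n f}"
    using assms(1) unfolding recognizable_def by blast
  obtain E2 :: "(bool list \<times> 'a \<times> bool list) set" and I2 F2 where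
    2: "finite E2" "finite I2" "finite F2" "E2 \<subseteq> UNIV \<times> B \<times> UNIV"
      "T = {n. \<exists>i\<in>I2. \<exists>f\<in>F2. path N E2 i n f}"
    using assms(2) unfolding recognizable_def by blast
  define E where "E = copy True E1 \<union> copy False E2"
  define I where "I = (#) True ` I1 \<union> (#) False ` I2"
  define F where "F = (#) True ` F1 \<union> (#) False ` F2"
  have inv: "\<exists>q'. q = b # q' \<and> path N (if b then E1 else E2) p' n q'"
    if "path N E p n q" "p = b # p'" for p n q b p'
    using that
  proof (induction arbitrary: p')
    case (step p a r n q)
    then obtain r' where "r = b # r'" "(p', a, r') \<in> (if b then E1 else E2)"
      by (auto simp: E_def mem_copy)
    then show ?case using step.IH[of r'] by (auto intro: path.step)
  qed (auto intro: path.refl)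
  have lift: "path N E (b # p) n (b # q)" if "path N (if b then E1 else E2) p n q" for b p n q
    using that by (rule path_map) (auto simp: E_def mem_copy split: if_splits)
  have "S \<union> T = {n. \<exists>i\<in>I. \<exists>f\<in>F. path N E i n f}"
  proof (intro equalityI subsetI)
    fix n assume "n \<in> S \<union> T"
    then show "n \<in> {n. \<exists>i\<in>I. \<exists>f\<in>F. path N E i n f}"
      using lift[of True] lift[of False] unfolding 1 2 I_def F_def by simp blast
  next
    fix n assume "n \<in> {n. \<exists>i\<in>I. \<exists>f\<in>F. path N E i n f}"
    then obtain i f where *: "i \<in> I" "f \<in> F" "path N E i n f" by auto
    moreover obtain b i' where "i = b # i'" using *(1) by (auto simp: I_def)
    ultimately show "n \<in> S \<union> T"
      using inv[of i n f b i'] unfolding 1 2 I_def F_def by auto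
  qed
  moreover have "finite E" "finite I" "finite F" "E \<subseteq> UNIV \<times> B \<times> UNIV"
    using 1 2 by (auto simp: E_def I_def F_def copy_def)
  ultimately show ?thesis unfolding recognizable_def by blast
qed

context monoid
begin

text \<open>Two states and one edge suffice: the final state has no outgoing edge, so the edge is
  the only path between them.\<close>

lemma recognizable_singleton:
  assumes "a \<in> B" "B \<subseteq> carrier G"
  shows "recognizable G B {a}"
proof -
  define E where "E = {([True], a, [False])}"
  have *: "n = \<one> \<and> q = [False]" if "path G E p n q" "p = [False]" for p q n
    using that by induction (auto simp: E_def)
  have to_a: "n = a" if "path G E [True] n [False]" for n
    using that
  proof cases
    case (step a' r n')
    then show ?thesis using *[of r n' "[False]"] assms by (auto simp: E_def)
  qed auto
  have "path G E [True] a [False]"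
    using assms by (intro path_edge) (auto simp: E_def)
  then have "path G E [True] n [False] \<longleftrightarrow> n = a" for n
    using to_a[of n] by (intro iffI) simp_all
  then have "{a} = {n. \<exists>i\<in>{[True]}. \<exists>f\<in>{[False]}. path G E i n f}"
    by simp
  moreover have "finite E" "E \<subseteq> UNIV \<times> B \<times> UNIV" using assms by (auto simp: E_def)
  moreover have "finite {[True]}" "finite {[False]}" by simp_all
  ultimately show ?thesis unfolding recognizable_def by (intro exI conjI)
qed

text \<open>Unit-labelled edges lead from the final states of the first copy to the initial states
  of the second; \<open>\<one> \<in> B\<close> makes these labels admissible.\<close>

lemma recognizable_product:
  assumes "recognizable G B S" "recognizable G B T" and B: "B \<subseteq> carrier G" "\<one> \<in> B"
  shows "recognizable G B (S <#> T)"
proof -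
  obtain E1 :: "(bool list \<times> 'a \<times> bool list) set" and I1 F1 where
    1: "finite E1" "finite I1" "finite F1" "E1 \<subseteq> UNIV \<times> B \<times> UNIV"
      "S = {n. \<exists>i\<in>I1. \<exists>f\<in>F1. path G E1 i n f}"
    using assms(1) unfolding recognizable_def by blast
  obtain E2 :: "(bool list \<times> 'a \<times> bool list) set" and I2 F2 where
    2: "finite E2" "finite I2" "finite F2" "E2 \<subseteq> UNIV \<times> B \<times> UNIV"
      "T = {n. \<exists>i\<in>I2. \<exists>f\<in>F2. path G E2 i n f}"
    using assms(2) unfolding recognizable_def by blast
  have C1: "E1 \<subseteq> UNIV \<times> carrier G \<times> UNIV" and C2: "E2 \<subseteq> UNIV \<times> carrier G \<times> UNIV"
    using 1 2 B by auto
  define J where "J = (\<lambda>(f, i). (True # f, \<one>, False # i)) ` (F1 \<times> I2)"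
  define E where "E = copy True E1 \<union> copy False E2 \<union> J"
  have E: "E \<subseteq> UNIV \<times> B \<times> UNIV"
    using 1 2 B by (auto simp: E_def J_def copy_def)
  then have CE: "E \<subseteq> UNIV \<times> carrier G \<times> UNIV" using B by auto
  have inv2: "path G E2 p' n q'" if "path G E p n q" "p = False # p'" "q = False # q'" for p n q p' q'
    using that
  proof (induction arbitrary: p')
    case (step p a r n q)
    then obtain r' where "r = False # r'" "(p', a, r') \<in> E2"
      by (auto simp: E_def J_def mem_copy)
    then show ?case using step.IH[of r'] step.prems by (auto intro: path.step)
  qed (auto intro: path.refl)
  \<comment> \<open>No edge leads back to the first copy, so the path crosses by exactly one edge of
    \<open>J\<close> and is cut there.\<close>
  have inv1: "\<exists>f\<in>F1. \<exists>i\<in>I2. \<exists>m1 m2. path G E1 p' m1 f \<and> path G E2 i m2 q' \<and> n = m1 \<otimes> m2"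
    if "path G E p n q" "p = True # p'" "q = False # q'" for p n q p' q'
    using that
  proof (induction arbitrary: p')
    case (step p a r n q)
    from step.hyps(1) step.prems(1) consider
        (left) r' where "r = True # r'" "(p', a, r') \<in> E1"
      | (jump) i where "p' \<in> F1" "i \<in> I2" "a = \<one>" "r = False # i"
      by (auto simp: E_def J_def mem_copy)
    then show ?case
    proof cases
      case left
      then obtain f i m1 m2 where *: "f \<in> F1" "i \<in> I2" "path G E1 r' m1 f" "path G E2 i m2 q'"
          "n = m1 \<otimes> m2"
        using step by blast
      have "a \<in> carrier G" "m1 \<in> carrier G" "m2 \<in> carrier G"
        using left C1 path_closed[OF _ C1] path_closed[OF _ C2] * by auto
      then have "a \<otimes> n = (a \<otimes> m1) \<otimes> m2" using * by (simp add: m_assoc)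
      moreover have "path G E1 p' (a \<otimes> m1) f" using left * by (auto intro: path.step)
      ultimately show ?thesis using * by blast
    next
      case jump
      then have "path G E2 i n q'" using inv2 step by blast
      moreover have "path G E1 p' \<one> p'" by (rule path.refl)
      ultimately show ?thesis using jump by blast
    qed
  qed auto
  have "S <#> T = {n. \<exists>i\<in>(#) True ` I1. \<exists>f\<in>(#) False ` F2. path G E i n f}"
  proof (intro equalityI subsetI)
    fix n assume "n \<in> S <#> T"
    then obtain i f i' f' m m' where *: "i \<in> I1" "f \<in> F1" "path G E1 i m f"
        "i' \<in> I2" "f' \<in> F2" "path G E2 i' m' f'" "n = m \<otimes> m'"
      unfolding mem_set_mult 1 2 by auto
    have "path G E (True # i) m (True # f)"
      using *(3) by (rule path_map) (auto simp: E_def mem_copy)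
    moreover have "path G E (False # i') m' (False # f')"
      using *(6) by (rule path_map) (auto simp: E_def mem_copy)
    moreover have "path G E (True # f) \<one> (False # i')"
      using * by (intro path_edge) (auto simp: E_def J_def)
    ultimately have "path G E (True # i) (m \<otimes> (\<one> \<otimes> m')) (False # f')"
      using path_trans[OF _ path_trans[OF _ _ CE] CE] by blast
    then show "n \<in> {n. \<exists>i\<in>(#) True ` I1. \<exists>f\<in>(#) False ` F2. path G E i n f}"
      using * path_closed[OF *(6) C2] by auto
  next
    fix n assume "n \<in> {n. \<exists>i\<in>(#) True ` I1. \<exists>f\<in>(#) False ` F2. path G E i n f}"
    then show "n \<in> S <#> T"
      using inv1 unfolding mem_set_mult 1 2 by blast
  qed
  moreover have "finite E"
    using 1 2 by (auto simp: E_def J_def copy_def)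
  ultimately show ?thesis using E 1 2 unfolding recognizable_def by blast
qed

text \<open>Unit-labelled edges lead from final states back to initial ones. The empty product is
  added separately, because an accepting path always contributes at least one factor from
  \<open>S\<close>.\<close>

lemma recognizable_star:
  assumes "recognizable G B S" and B: "B \<subseteq> carrier G" "\<one> \<in> B"
  shows "recognizable G B (mon_star G S)"
proof -
  obtain E :: "(bool list \<times> 'a \<times> bool list) set" and I F where
    1: "finite E" "finite I" "finite F" "E \<subseteq> UNIV \<times> B \<times> UNIV"
      "S = {n. \<exists>i\<in>I. \<exists>f\<in>F. path G E i n f}"
    using assms(1) unfolding recognizable_def by blast
  have C: "E \<subseteq> UNIV \<times> carrier G \<times> UNIV" using 1 B by auto
  have S: "S \<subseteq> carrier G" unfolding 1 using path_closed[OF _ C] by auto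
  define E' where "E' = E \<union> (\<lambda>(f, i). (f, \<one>, i)) ` (F \<times> I)"
  have E': "E' \<subseteq> UNIV \<times> B \<times> UNIV" using 1 B by (auto simp: E'_def)
  then have C': "E' \<subseteq> UNIV \<times> carrier G \<times> UNIV" using B by auto
  have lift: "path G E' p n q" if "path G E p n q" for p n q
    using path_map[OF that, of id E'] by (auto simp: E'_def)
  \<comment> \<open>The start \<open>p\<close> is arbitrary to make the induction work: up to the
    first return edge the path stays in \<open>E\<close> and ends in \<open>F\<close>, and each
    later piece contributes a factor from \<open>S\<close>.\<close>
  have inv: "\<exists>f\<in>F. \<exists>m s. path G E p m f \<and> s \<in> mon_star G S \<and> n = m \<otimes> s"
    if "path G E' p n q" "q \<in> F" for p n q
    using that
  proof (induction)
    case (refl p)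
    then show ?case using path.refl[of G E p] mon_star.one[of G S] one_closed r_one by metis
  next
    case (step p a r n q)
    then obtain f m s where *: "f \<in> F" "path G E r m f" "s \<in> mon_star G S" "n = m \<otimes> s"
      by blast
    have cl: "m \<in> carrier G" "s \<in> carrier G"
      using * path_closed[OF _ C] mon_star_closed[OF _ S] by auto
    from step.hyps(1) consider "(p, a, r) \<in> E" | "p \<in> F" "r \<in> I" "a = \<one>"
      by (auto simp: E'_def)
    then show ?case
    proof cases
      case 1
      then have "path G E p (a \<otimes> m) f" using * by (auto intro: path.step)
      moreover have "a \<otimes> n = (a \<otimes> m) \<otimes> s" using 1 C cl * by (auto simp: m_assoc)
      ultimately show ?thesis using * by blast
    next
      case 2
      then have "m \<in> S" using * 1 by auto
      then have "n \<in> mon_star G S" using * by (simp add: mon_star.mult)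
      moreover have "path G E p \<one> p" by (rule path.refl)
      moreover have "a \<otimes> n = \<one> \<otimes> n" using 2 by simp
      ultimately show ?thesis using 2 by blast
    qed
  qed
  have fwd: "s = \<one> \<or> (\<exists>i\<in>I. \<exists>f\<in>F. path G E' i s f)" if "s \<in> mon_star G S" for s
    using that
  proof induction
    case (mult a s)
    then obtain i f where *: "i \<in> I" "f \<in> F" "path G E i a f" using 1 by auto
    then have a: "path G E' i a f" "a \<in> carrier G" using lift path_closed[OF _ C] by auto
    from mult.IH show ?case
    proof
      assume "s = \<one>"
      then show ?thesis using * a by auto
    next
      assume "\<exists>i\<in>I. \<exists>f\<in>F. path G E' i s f"
      then obtain i' f' where **: "i' \<in> I" "f' \<in> F" "path G E' i' s f'" by blast
      have "path G E' f (\<one> \<otimes> s) f'"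
        using * ** by (intro path.step[of f \<one> i']) (auto simp: E'_def)
      then have "path G E' i (a \<otimes> (\<one> \<otimes> s)) f'" using path_trans[OF a(1) _ C'] by blast
      then show ?thesis using * ** path_closed[OF **(3) C'] by auto
    qed
  qed simp
  have "mon_star G S = {\<one>} \<union> {n. \<exists>i\<in>I. \<exists>f\<in>F. path G E' i n f}"
  proof (intro equalityI subsetI)
    fix n assume "n \<in> {\<one>} \<union> {n. \<exists>i\<in>I. \<exists>f\<in>F. path G E' i n f}"
    then consider "n = \<one>" | i f where "i \<in> I" "f \<in> F" "path G E' i n f" by auto
    then show "n \<in> mon_star G S"
    proof cases
      case 2
      then obtain f' m s where "f' \<in> F" "path G E i m f'" "s \<in> mon_star G S" "n = m \<otimes> s"
        using inv by blast
      then show ?thesis using 2 1 by (auto intro: mon_star.mult)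
    qed (simp add: mon_star.one)
  qed (use fwd in auto)
  moreover have "recognizable G B {n. \<exists>i\<in>I. \<exists>f\<in>F. path G E' i n f}" (is "recognizable G B ?P")
    unfolding recognizable_def using 1 E' by (intro exI[of _ E'] exI[of _ I] exI[of _ F]) (auto simp: E'_def)
  then have "recognizable G B ({\<one>} \<union> ?P)"
    by (intro recognizable_union recognizable_singleton B)
  ultimately show ?thesis by simp
qed

lemma recognizable_finite:
  assumes "finite S" "\<And>a. a \<in> S \<Longrightarrow> recognizable G B {a}"
  shows "recognizable G B S"
  using assms
proof (induction rule: finite_induct)
  case (insert a S)
  have "recognizable G B {a}" "recognizable G B S" using insert.prems insert.IH by blast+
  then show ?case using recognizable_union[of G B "{a}" S] by simp
qed (rule recognizable_empty)

text \<open>Kleene's theorem from rational sets to automata. The freedom to take labels from a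
  generating set \<open>B\<close> is what later yields edges that read at most one letter.\<close>

theorem rational_imp_recognizable:
  assumes "rational G S" and B: "B \<subseteq> carrier G" "\<one> \<in> B" "carrier G \<subseteq> mon_star G B"
  shows "recognizable G B S"
proof -
  \<comment> \<open>Every element is a product of elements of \<open>B\<close>, so its automaton is
    a concatenation of one-edge automata.\<close>
  have gen: "recognizable G B {a}" if "a \<in> mon_star G B" for a
    using that
  proof induction
    case one
    show ?case by (intro recognizable_singleton B)
  next
    case (mult a s)
    then have "recognizable G B ({a} <#> {s})"
      using recognizable_product recognizable_singleton B by simp
    then show ?case by (simp add: set_mult_def)
  qed
  from assms(1) show ?thesis
  proof (induction rule: rational_mon_induct)
    case (finite S)
    then have "recognizable G B {a}" if "a \<in> S" for a using that gen B(3) by blast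
    then show ?case by (rule recognizable_finite[OF finite(1)])
  next
    case (union S T)
    then show ?case by (intro recognizable_union)
  next
    case (product S T)
    then show ?case by (intro recognizable_product B)
  next
    case (star S)
    then show ?case by (intro recognizable_star B)
  qed
qed

end

section \<open>Composition of rational relations through a free monoid\<close>

lemma free_monoid_simps [simp]:
  "carrier (free_monoid A) = lists A"
  "u \<otimes>\<^bsub>free_monoid A\<^esub> v = u @ v"
  "\<one>\<^bsub>free_monoid A\<^esub> = []"
  by (simp_all add: free_monoid_def)

lemma monoid_free_monoid: "monoid (free_monoid A)"
  by unfold_locales (auto simp: lists_eq_set)

lemma DirProd_simps [simp]:
  "carrier (M \<times>\<times> N) = carrier M \<times> carrier N"
  "x \<otimes>\<^bsub>M \<times>\<times> N\<^esub> y = (fst x \<otimes>\<^bsub>M\<^esub> fst y, snd x \<otimes>\<^bsub>N\<^esub> snd y)"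
  "\<one>\<^bsub>M \<times>\<times> N\<^esub> = (\<one>\<^bsub>M\<^esub>, \<one>\<^bsub>N\<^esub>)"
  by (auto simp: DirProd_def split: prod.splits)

section \<open>Automata that read at most one letter per edge\<close>

text \<open>Only the word component is restricted: words have to be cut at arbitrary positions,
  while the elements of \<open>M\<close> are never split.\<close>

definition letter_labels :: "('m, 'e) monoid_scheme \<Rightarrow> 'a set \<Rightarrow> ('m \<times> 'a list) set" where
  "letter_labels M A = carrier M \<times> {u \<in> lists A. length u \<le> 1}"

text \<open>The word is produced letter by letter with unit first component, and a last factor
  \<open>(m, [])\<close> supplies \<open>m\<close>.\<close>

lemma letter_labels_generate:
  assumes "monoid M"
  shows "carrier (M \<times>\<times> free_monoid A) \<subseteq> mon_star (M \<times>\<times> free_monoid A) (letter_labels M A)"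
proof -
  interpret M: monoid M by fact
  have "(m, u) \<in> mon_star (M \<times>\<times> free_monoid A) (letter_labels M A)"
    if "m \<in> carrier M" "u \<in> lists A" for m u
    using that(2)
  proof (induction u)
    case Nil
    have "(m, []) \<in> letter_labels M A" using that by (simp add: letter_labels_def)
    from mon_star.mult[OF this mon_star.one[of "M \<times>\<times> free_monoid A"]] that(1) show ?case by simp
  next
    case (Cons a u)
    then have "(\<one>\<^bsub>M\<^esub>, [a]) \<in> letter_labels M A" by (simp add: letter_labels_def)
    from mon_star.mult[OF this Cons.IH] that(1) show ?case by simp
  qed
  then show ?thesis by auto
qed

text \<open>Initial and final states are left out because the argument needs the runs between all
  pairs of states.\<close>

locale letter_automaton =
  M: monoid M for M :: "('m, 'e) monoid_scheme" +
  fixes A :: "'a set" and E :: "('s \<times> ('m \<times> 'a list) \<times> 's) set" and Q :: "'s set"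
  assumes finite_edges: "finite E" and finite_states: "finite Q"
    and edges: "E \<subseteq> Q \<times> letter_labels M A \<times> Q"
begin

abbreviation run :: "'s \<Rightarrow> 'm \<Rightarrow> 'a list \<Rightarrow> 's \<Rightarrow> bool" where
  "run p m u q \<equiv> path (M \<times>\<times> free_monoid A) E p (m, u) q"

lemma edge_carrier: "E \<subseteq> UNIV \<times> carrier (M \<times>\<times> free_monoid A) \<times> UNIV"
  using edges by (auto simp: letter_labels_def)

lemma monoid_MA: "monoid (M \<times>\<times> free_monoid A)"
  by (intro DirProd_monoid M.monoid_axioms monoid_free_monoid)

lemma run_closed: "run p m u q \<Longrightarrow> m \<in> carrier M" "run p m u q \<Longrightarrow> u \<in> lists A"
  using monoid.path_closed[OF monoid_MA _ edge_carrier] by fastforce+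

lemma run_refl: "run p \<one>\<^bsub>M\<^esub> [] p"
  using path.refl[of "M \<times>\<times> free_monoid A" E p] by simp

lemma run_step: "(p, (m, u), r) \<in> E \<Longrightarrow> run r n v q \<Longrightarrow> run p (m \<otimes>\<^bsub>M\<^esub> n) (u @ v) q"
  using path.step[of p "(m, u)" r E "M \<times>\<times> free_monoid A" "(n, v)" q] by simp

lemma run_trans: "run p m u r \<Longrightarrow> run r n v q \<Longrightarrow> run p (m \<otimes>\<^bsub>M\<^esub> n) (u @ v) q"
  using monoid.path_trans[OF monoid_MA _ _ edge_carrier, of p "(m, u)" r "(n, v)" q] by simp

lemma run_induct [consumes 1, case_names refl step]:
  assumes "run p m u q"
    and "\<And>p. P p \<one>\<^bsub>M\<^esub> [] p"
    and "\<And>p a w r n v q. (p, (a, w), r) \<in> E \<Longrightarrow> a \<in> carrier M \<Longrightarrow> r \<in> Q \<Longrightarrow> length w \<le> 1 \<Longrightarrow>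
      run r n v q \<Longrightarrow> n \<in> carrier M \<Longrightarrow> P r n v q \<Longrightarrow> P p (a \<otimes>\<^bsub>M\<^esub> n) (w @ v) q"
  shows "P p m u q"
proof -
  have "P p (fst x) (snd x) q" if "path (M \<times>\<times> free_monoid A) E p x q" for p x q
    using that
  proof induction
    case (step p a r n q)
    then have "run r (fst n) (snd n) q" by simp
    moreover have "a \<in> letter_labels M A" "r \<in> Q" using step.hyps(1) edges by auto
    ultimately show ?case
      using step.hyps(1) step.IH run_closed(1)[of r "fst n" "snd n" q]
        assms(3)[of p "fst a" "snd a" r "fst n" "snd n" q]
      by (simp add: letter_labels_def mem_Times_iff)
  qed (simp add: assms(2))
  from this[of p "(m, u)" q] show ?thesis using assms(1) by simp
qed

text \<open>An edge reads at most one letter, so none straddles the boundary between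
  \<open>u\<close> and \<open>v\<close>; the run is cut there, and its label in \<open>M\<close>
  factors accordingly.\<close>

lemma run_append:
  assumes "run p m (u @ v) q" "p \<in> Q"
  shows "\<exists>r\<in>Q. \<exists>k l. run p k u r \<and> run r l v q \<and> m = k \<otimes>\<^bsub>M\<^esub> l"
proof -
  have "\<exists>r\<in>Q. \<exists>k l. run p k u r \<and> run r l v q \<and> m = k \<otimes>\<^bsub>M\<^esub> l"
    if "run p m w q" "w = u @ v" "p \<in> Q" for p m w q u
    using that
  proof (induction arbitrary: u rule: run_induct)
    case (refl p)
    then have "u = []" "v = []" by auto
    moreover have "\<one>\<^bsub>M\<^esub> = \<one>\<^bsub>M\<^esub> \<otimes>\<^bsub>M\<^esub> \<one>\<^bsub>M\<^esub>" by simp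
    ultimately show ?case using refl run_refl[of p] by metis
  next
    case (step p a w r n w' q)
    have base: ?case if "u = []"
    proof -
      have "run p (a \<otimes>\<^bsub>M\<^esub> n) v q" using step.hyps(1,5) step.prems(1) that run_step by fastforce
      moreover have "a \<otimes>\<^bsub>M\<^esub> n = \<one>\<^bsub>M\<^esub> \<otimes>\<^bsub>M\<^esub> (a \<otimes>\<^bsub>M\<^esub> n)" using step.hyps by simp
      ultimately show ?thesis using that step.prems(2) run_refl[of p] by blast
    qed
    show ?case
    proof (cases "u = []")
      case False
      \<comment> \<open>As \<open>u\<close> is nonempty and \<open>w\<close> has at most one letter,
        the first edge reads a prefix of \<open>u\<close>.\<close>
      obtain u' where u': "u = w @ u'" "w' = u' @ v"
      proof (cases w)
        case Nil
        then show ?thesis using that step.prems by simp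
      next
        case (Cons c w0)
        then have "w = [c]" using step.hyps(4) by simp
        then show ?thesis using that step.prems(1) False by (auto simp: Cons_eq_append_conv)
      qed
      from step.IH[OF u'(2) step.hyps(3)] obtain s k l where
        s: "s \<in> Q" "run r k u' s" "run s l v q" "n = k \<otimes>\<^bsub>M\<^esub> l" by blast
      have "run p (a \<otimes>\<^bsub>M\<^esub> k) u s" using run_step[OF step.hyps(1) s(2)] u' by simp
      moreover have "a \<otimes>\<^bsub>M\<^esub> n = (a \<otimes>\<^bsub>M\<^esub> k) \<otimes>\<^bsub>M\<^esub> l"
        using s step.hyps run_closed(1) by (simp add: M.m_assoc)
      ultimately show ?thesis using s by blast
    qed (use base in simp)
  qed
  then show ?thesis using assms by blast
qed

text \<open>Exactly one edge of the run reads a letter; the edges before and after it read the empty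
  word.\<close>

lemma run_letter:
  assumes "run p m [c] q" "p \<in> Q"
  shows "\<exists>r\<in>Q. \<exists>s\<in>Q. \<exists>k a l. run p k [] r \<and> (r, (a, [c]), s) \<in> E \<and> run s l [] q \<and>
    m = k \<otimes>\<^bsub>M\<^esub> (a \<otimes>\<^bsub>M\<^esub> l)"
proof -
  have "\<exists>r\<in>Q. \<exists>s\<in>Q. \<exists>k a l. run p k [] r \<and> (r, (a, [c]), s) \<in> E \<and> run s l [] q \<and>
    m = k \<otimes>\<^bsub>M\<^esub> (a \<otimes>\<^bsub>M\<^esub> l)"
    if "run p m w q" "w = [c]" "p \<in> Q" for p m w q
    using that
  proof (induction rule: run_induct)
    case (step p a w r n w' q)
    show ?case
    proof (cases w)
      case Nil
      then have "w' = [c]" using step.prems by simp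
      from step.IH[OF this step.hyps(3)] obtain r' s k a' l where
        s: "r' \<in> Q" "s \<in> Q" "run r k [] r'" "(r', (a', [c]), s) \<in> E" "run s l [] q"
          "n = k \<otimes>\<^bsub>M\<^esub> (a' \<otimes>\<^bsub>M\<^esub> l)" by blast
      have "run p (a \<otimes>\<^bsub>M\<^esub> k) [] r'" using run_step[OF _ s(3), of p a "[]"] step.hyps(1) Nil by simp
      moreover have "a' \<in> carrier M" using s(4) edges by (auto simp: letter_labels_def)
      then have "a \<otimes>\<^bsub>M\<^esub> n = (a \<otimes>\<^bsub>M\<^esub> k) \<otimes>\<^bsub>M\<^esub> (a' \<otimes>\<^bsub>M\<^esub> l)"
        using s step.hyps run_closed(1) by (simp add: M.m_assoc)
      ultimately show ?thesis using s by blast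
    next
      case (Cons c' w0)
      then have "w = [c]" "w' = []" using step by auto
      then have "(p, (a, [c]), r) \<in> E" "run r n [] q" using step.hyps by auto
      moreover have "a \<otimes>\<^bsub>M\<^esub> n = \<one>\<^bsub>M\<^esub> \<otimes>\<^bsub>M\<^esub> (a \<otimes>\<^bsub>M\<^esub> n)" using step.hyps by simp
      ultimately show ?thesis using run_refl[of p] step.hyps(3) step.prems(2) by blast
    qed
  qed simp
  then show ?thesis using assms by blast
qed


section \<open>Relations read along runs\<close>

text \<open>This is the composite \<open>{(m, u). run p m u q} O T\<close>, kept separate for each
  pair of states so that it can be treated by induction on \<open>T\<close>.\<close>

definition through :: "'s \<Rightarrow> ('a list \<times> 'k) set \<Rightarrow> 's \<Rightarrow> ('m \<times> 'k) set" where
  "through p T q = {(m, v). \<exists>u. run p m u q \<and> (u, v) \<in> T}"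

lemma mem_through: "(m, v) \<in> through p T q \<longleftrightarrow> (\<exists>u. run p m u q \<and> (u, v) \<in> T)"
  by (simp add: through_def)

text \<open>When the word splits, the run splits at some state \<open>r\<close> by
  \<open>run_append\<close>; conversely, runs that meet at \<open>r\<close> are joined. The union is
  finite because \<open>Q\<close> is.\<close>

lemma through_product:
  assumes "p \<in> Q"
  shows "through p (S <#>\<^bsub>free_monoid A \<times>\<times> K\<^esub> T) q =
    (\<Union>r\<in>Q. through p S r <#>\<^bsub>M \<times>\<times> K\<^esub> through r T q)"
proof (intro equalityI subsetI)
  fix x assume "x \<in> through p (S <#>\<^bsub>free_monoid A \<times>\<times> K\<^esub> T) q"
  then obtain m u v u' v' where x: "x = (m, v \<otimes>\<^bsub>K\<^esub> v')" "run p m (u @ u') q"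
      "(u, v) \<in> S" "(u', v') \<in> T"
    by (auto simp: through_def mem_set_mult)
  then obtain r k l where r: "r \<in> Q" "run p k u r" "run r l u' q" "m = k \<otimes>\<^bsub>M\<^esub> l"
    using run_append assms by blast
  then have "(k, v) \<in> through p S r" "(l, v') \<in> through r T q"
    using x by (auto simp: mem_through)
  from set_multI[OF this, of "M \<times>\<times> K"] x r
  show "x \<in> (\<Union>r\<in>Q. through p S r <#>\<^bsub>M \<times>\<times> K\<^esub> through r T q)" by auto
next
  fix x assume "x \<in> (\<Union>r\<in>Q. through p S r <#>\<^bsub>M \<times>\<times> K\<^esub> through r T q)"
  then obtain r k v l v' where r: "(k, v) \<in> through p S r" "(l, v') \<in> through r T q"
      "x = (k \<otimes>\<^bsub>M\<^esub> l, v \<otimes>\<^bsub>K\<^esub> v')"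
    by (auto simp: mem_set_mult)
  then obtain u u' where u: "run p k u r" "(u, v) \<in> S" "run r l u' q" "(u', v') \<in> T"
    by (auto simp: mem_through)
  have "(u @ u', v \<otimes>\<^bsub>K\<^esub> v') \<in> S <#>\<^bsub>free_monoid A \<times>\<times> K\<^esub> T"
    using set_multI[OF u(2,4), of "free_monoid A \<times>\<times> K"] by simp
  then show "x \<in> through p (S <#>\<^bsub>free_monoid A \<times>\<times> K\<^esub> T) q"
    using r(3) run_trans[OF u(1,3)] by (auto simp: mem_through)
qed

text \<open>Discarding the edges that read a letter, and replacing the empty word by the unit of
  \<open>K\<close>, gives a finite automaton over \<open>M \<times>\<times> K\<close>, to which
  Kleene's theorem applies.\<close>

lemma rational_silent:
  assumes "monoid K"
  shows "rational (M \<times>\<times> K) (through p {([], \<one>\<^bsub>K\<^esub>)} q)"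
proof -
  interpret K: monoid K by fact
  define E' where "E' = {(r, (m, \<one>\<^bsub>K\<^esub>), s) | r m s. (r, (m, []), s) \<in> E}"
  have "E' \<subseteq> (\<lambda>(r, (m, u), s). (r, (m, \<one>\<^bsub>K\<^esub>), s)) ` E"
    by (force simp: E'_def)
  then have "finite E'" using finite_edges finite_surj by blast
  have E': "E' \<subseteq> Q \<times> carrier (M \<times>\<times> K) \<times> Q"
    using edges by (auto simp: E'_def letter_labels_def)
  have fwd: "run p (fst x) [] q \<and> snd x = \<one>\<^bsub>K\<^esub>" if "path (M \<times>\<times> K) E' p x q" for p x q
    using that
  proof induction
    case (refl p)
    then show ?case by (simp add: run_refl)
  next
    case (step p a r n q)
    then obtain m where "a = (m, \<one>\<^bsub>K\<^esub>)" "(p, (m, []), r) \<in> E" by (auto simp: E'_def)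
    then show ?case using step.IH run_step[of p m "[]" r "fst n" "[]" q] by simp
  qed
  have bwd: "u = [] \<longrightarrow> path (M \<times>\<times> K) E' p (m, \<one>\<^bsub>K\<^esub>) q" if "run p m u q" for p m u q
    using that
  proof (induction rule: run_induct)
    case (refl p)
    then show ?case using path.refl[of "M \<times>\<times> K" E' p] by simp
  next
    case (step p a w r n v q)
    show ?case
    proof
      assume "w @ v = []"
      then have "(p, (a, \<one>\<^bsub>K\<^esub>), r) \<in> E'" "path (M \<times>\<times> K) E' r (n, \<one>\<^bsub>K\<^esub>) q"
        using step by (auto simp: E'_def)
      from path.step[OF this] show "path (M \<times>\<times> K) E' p (a \<otimes>\<^bsub>M\<^esub> n, \<one>\<^bsub>K\<^esub>) q" by simp
    qed
  qed
  have "x \<in> through p {([], \<one>\<^bsub>K\<^esub>)} q \<longleftrightarrow> path (M \<times>\<times> K) E' p x q" for x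
    using fwd[of p x q] bwd[of p "fst x" "[]" q] by (cases x) (auto simp: mem_through)
  then have "through p {([], \<one>\<^bsub>K\<^esub>)} q = {x. path (M \<times>\<times> K) E' p x q}" by blast
  moreover have "rational (M \<times>\<times> K) {a. (r, a, s) \<in> E'}" for r s
  proof (rule rational.finite)
    have "{a. (r, a, s) \<in> E'} \<subseteq> (fst \<circ> snd) ` E'" by force
    then show "finite {a. (r, a, s) \<in> E'}" using \<open>finite E'\<close> finite_surj by blast
  qed (use E' in auto)
  then have "rational (M \<times>\<times> K) {x. path (M \<times>\<times> K) E' p x q}"
    using monoid.rational_path[OF DirProd_monoid[OF M.monoid_axioms assms] finite_states E']
    by blast
  ultimately show ?thesis by simp
qed

text \<open>By \<open>run_letter\<close> such a run is a silent run, an edge reading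
  \<open>c\<close> and another silent run; the union ranges over the two ends of that edge.\<close>

lemma rational_through_letter:
  assumes "monoid K" "p \<in> Q"
  shows "rational (M \<times>\<times> K) (through p {([c], \<one>\<^bsub>K\<^esub>)} q)"
proof -
  interpret K: monoid K by fact
  let ?e = "{([], \<one>\<^bsub>K\<^esub>)}"
  let ?X = "\<lambda>r s. {(a, \<one>\<^bsub>K\<^esub>) | a. (r, (a, [c]), s) \<in> E}"
  have "through p {([c], \<one>\<^bsub>K\<^esub>)} q =
    (\<Union>r\<in>Q. \<Union>s\<in>Q. through p ?e r <#>\<^bsub>M \<times>\<times> K\<^esub> (?X r s <#>\<^bsub>M \<times>\<times> K\<^esub> through s ?e q))"
  proof (intro equalityI subsetI)
    fix x assume "x \<in> through p {([c], \<one>\<^bsub>K\<^esub>)} q"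
    then obtain m where x: "x = (m, \<one>\<^bsub>K\<^esub>)" "run p m [c] q" by (auto simp: through_def)
    from run_letter[OF x(2) assms(2)] obtain r s k a l where
      r: "r \<in> Q" "s \<in> Q" "run p k [] r" "(r, (a, [c]), s) \<in> E" "run s l [] q"
        "m = k \<otimes>\<^bsub>M\<^esub> (a \<otimes>\<^bsub>M\<^esub> l)" by blast
    have "(k, \<one>\<^bsub>K\<^esub>) \<in> through p ?e r" "(a, \<one>\<^bsub>K\<^esub>) \<in> ?X r s" "(l, \<one>\<^bsub>K\<^esub>) \<in> through s ?e q"
      using r by (auto simp: mem_through)
    from set_multI[OF this(1) set_multI[OF this(2,3), of "M \<times>\<times> K"], of "M \<times>\<times> K"]
       have "x \<in> through p ?e r <#>\<^bsub>M \<times>\<times> K\<^esub> (?X r s <#>\<^bsub>M \<times>\<times> K\<^esub> through s ?e q)"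
      using x(1) r(6) by simp
    then show "x \<in> (\<Union>r\<in>Q. \<Union>s\<in>Q. through p ?e r <#>\<^bsub>M \<times>\<times> K\<^esub> (?X r s <#>\<^bsub>M \<times>\<times> K\<^esub> through s ?e q))"
      using r(1,2) by blast
  next
    fix x
    assume "x \<in> (\<Union>r\<in>Q. \<Union>s\<in>Q. through p ?e r <#>\<^bsub>M \<times>\<times> K\<^esub> (?X r s <#>\<^bsub>M \<times>\<times> K\<^esub> through s ?e q))"
    then obtain r s k a l where "run p k [] r" "(r, (a, [c]), s) \<in> E" "run s l [] q"
        "x = (k \<otimes>\<^bsub>M\<^esub> (a \<otimes>\<^bsub>M\<^esub> l), \<one>\<^bsub>K\<^esub>)"
      by (auto simp: mem_set_mult mem_through)
    then show "x \<in> through p {([c], \<one>\<^bsub>K\<^esub>)} q"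
      using run_trans[OF _ run_step, of p k "[]" r a "[c]" s l "[]" q] by (auto simp: mem_through)
  qed
  moreover have "rational (M \<times>\<times> K) (?X r s)" for r s
  proof (rule rational.finite)
    have "?X r s \<subseteq> (\<lambda>(r, (a, u), s). (a, \<one>\<^bsub>K\<^esub>)) ` E" by force
    then show "finite (?X r s)" using finite_edges finite_surj by blast
  qed (use edges in \<open>auto simp: letter_labels_def\<close>)
  ultimately show ?thesis
    using finite_states by (auto intro!: rational_UN rational.product rational_silent assms)
qed

lemma rational_through_word:
  assumes "monoid K" "v \<in> carrier K" "p \<in> Q"
  shows "rational (M \<times>\<times> K) (through p {(u, v)} q)"
  using assms(3)
proof (induction u arbitrary: p)
  interpret K: monoid K by fact
  {
    case Nil
    \<comment> \<open>The output \<open>v\<close> is appended to the silent runs as a separate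
      factor.\<close>
    have "through p {([], v)} q = through p {([], \<one>\<^bsub>K\<^esub>)} q <#>\<^bsub>M \<times>\<times> K\<^esub> {(\<one>\<^bsub>M\<^esub>, v)}"
      using assms(2) run_closed(1) by (force simp: through_def mem_set_mult)
    moreover have "rational (M \<times>\<times> K) {(\<one>\<^bsub>M\<^esub>, v)}" using assms(2) by (simp add: rational.finite)
    ultimately show ?case by (simp only: rational.product[OF rational_silent[OF assms(1)]])
  next
    case (Cons c u)
    \<comment> \<open>The whole output is left to the tail \<open>u\<close>, so the letter
      \<open>c\<close> is paired with the unit.\<close>
    have "{(c # u, v)} = {([c], \<one>\<^bsub>K\<^esub>)} <#>\<^bsub>free_monoid A \<times>\<times> K\<^esub> {(u, v)}"
      using assms(2) by (simp add: set_mult_def)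
    then have "through p {(c # u, v)} q =
        (\<Union>r\<in>Q. through p {([c], \<one>\<^bsub>K\<^esub>)} r <#>\<^bsub>M \<times>\<times> K\<^esub> through r {(u, v)} q)"
      using through_product[OF Cons.prems] by simp
    then show ?case
      using finite_states Cons rational_through_letter assms(1)
      by (auto intro!: rational_UN rational.product)
  }
qed

text \<open>Cutting an element of the star into factors from \<open>T\<close> cuts the run into
  pieces, each of which is a single edge of the automaton \<open>E'\<close> on the same states. The
  silent factor at the end covers what the run does after the last factor: it reads only the empty
  word but may still change state and contribute an element of \<open>M\<close>.\<close>

lemma through_star:
  assumes "monoid K" "p \<in> Q" "q \<in> Q" and T: "T \<subseteq> carrier (free_monoid A \<times>\<times> K)"
  defines "E' \<equiv> {(r, x, s). r \<in> Q \<and> s \<in> Q \<and> x \<in> through r T s}"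
  shows "through p (mon_star (free_monoid A \<times>\<times> K) T) q =
    (\<Union>r\<in>Q. {x. path (M \<times>\<times> K) E' p x r} <#>\<^bsub>M \<times>\<times> K\<^esub> through r {([], \<one>\<^bsub>K\<^esub>)} q)"
proof (intro equalityI subsetI)
  interpret K: monoid K by fact
  let ?S = "mon_star (free_monoid A \<times>\<times> K) T"
  have star_closed: "v \<in> carrier K" if "(u, v) \<in> ?S" for u v
    using monoid.mon_star_closed[OF DirProd_monoid[OF monoid_free_monoid assms(1)] that T] by simp
  {
    have *: "\<exists>r\<in>Q. \<exists>k l. path (M \<times>\<times> K) E' p (k, snd y) r \<and> run r l [] q \<and> m = k \<otimes>\<^bsub>M\<^esub> l"
      if "y \<in> ?S" "run p m (fst y) q" "p \<in> Q" for y m p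
      using that
    proof (induction arbitrary: p m)
      case one
      moreover have "path (M \<times>\<times> K) E' p (\<one>\<^bsub>M\<^esub>, \<one>\<^bsub>K\<^esub>) p"
        using path.refl[of "M \<times>\<times> K" E' p] by simp
      moreover have "m = \<one>\<^bsub>M\<^esub> \<otimes>\<^bsub>M\<^esub> m" using run_closed(1)[OF one(1)] by simp
      ultimately show ?case by auto
    next
      case (mult a y)
      then obtain r k l where r: "r \<in> Q" "run p k (fst a) r" "run r l (fst y) q" "m = k \<otimes>\<^bsub>M\<^esub> l"
        using run_append[of p m "fst a" "fst y" q] by auto
      obtain s k' l' where s: "s \<in> Q" "path (M \<times>\<times> K) E' r (k', snd y) s" "run s l' [] q"
          "l = k' \<otimes>\<^bsub>M\<^esub> l'"
        using mult.IH[OF r(3,1)] by blast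
      have "(p, (k, snd a), r) \<in> E'"
        using r mult by (auto simp: E'_def mem_through intro!: exI[of _ "fst a"])
      from path.step[OF this s(2)] have "path (M \<times>\<times> K) E' p (k \<otimes>\<^bsub>M\<^esub> k', snd a \<otimes>\<^bsub>K\<^esub> snd y) s" by simp
      moreover have "k' \<in> carrier M"
      proof -
        have "E' \<subseteq> UNIV \<times> carrier (M \<times>\<times> K) \<times> UNIV"
          using T run_closed(1) by (fastforce simp: E'_def through_def)
        from monoid.path_closed[OF DirProd_monoid[OF M.monoid_axioms assms(1)] s(2) this]
        show ?thesis by simp
      qed
      then have "m = (k \<otimes>\<^bsub>M\<^esub> k') \<otimes>\<^bsub>M\<^esub> l'"
        using r s run_closed(1) by (simp add: M.m_assoc)
      ultimately show ?case using s by auto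
    qed
    fix x assume "x \<in> through p ?S q"
    then obtain m u v where x: "x = (m, v)" "run p m u q" "(u, v) \<in> ?S" by (auto simp: through_def)
    then obtain r k l where r: "r \<in> Q" "path (M \<times>\<times> K) E' p (k, v) r" "run r l [] q" "m = k \<otimes>\<^bsub>M\<^esub> l"
      using *[of "(u, v)" p m] assms(2) by auto
    have "(k, v) \<in> {x. path (M \<times>\<times> K) E' p x r}" "(l, \<one>\<^bsub>K\<^esub>) \<in> through r {([], \<one>\<^bsub>K\<^esub>)} q"
      using r by (auto simp: mem_through)
    from set_multI[OF this, of "M \<times>\<times> K"]
    show "x \<in> (\<Union>r\<in>Q. {x. path (M \<times>\<times> K) E' p x r} <#>\<^bsub>M \<times>\<times> K\<^esub> through r {([], \<one>\<^bsub>K\<^esub>)} q)"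
      using x r star_closed by auto
  }
  {
    have *: "x \<in> through p ?S r" if "path (M \<times>\<times> K) E' p x r" for p x r
      using that
    proof induction
      case (refl p)
      show ?case using run_refl mon_star.one[of "free_monoid A \<times>\<times> K" T] by (auto simp: mem_through)
    next
      case (step p a r n q)
      from step.hyps(1) obtain u where u: "run p (fst a) u r" "(u, snd a) \<in> T"
        by (auto simp: E'_def through_def)
      from step.IH obtain u' where u': "run r (fst n) u' q" "(u', snd n) \<in> ?S"
        by (auto simp: through_def)
      show ?case
        using run_trans[OF u(1) u'(1)] mon_star.mult[OF u(2) u'(2)] by (auto simp: mem_through)
    qed
    fix x
    assume "x \<in> (\<Union>r\<in>Q. {x. path (M \<times>\<times> K) E' p x r} <#>\<^bsub>M \<times>\<times> K\<^esub> through r {([], \<one>\<^bsub>K\<^esub>)} q)"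
    then obtain r k v l where r: "path (M \<times>\<times> K) E' p (k, v) r" "run r l [] q"
        "x = (k \<otimes>\<^bsub>M\<^esub> l, v \<otimes>\<^bsub>K\<^esub> \<one>\<^bsub>K\<^esub>)"
      by (auto simp: mem_set_mult mem_through)
    from *[OF r(1)] obtain u where u: "run p k u r" "(u, v) \<in> ?S" by (auto simp: mem_through)
    show "x \<in> through p ?S q"
      using run_trans[OF u(1) r(2)] r(3) u(2) star_closed[OF u(2)] by (auto simp: mem_through)
  }
qed

text \<open>The induction on \<open>T\<close> treats all pairs of states at once, because products
  and stars pass through arbitrary intermediate states.\<close>

lemma rational_through:
  assumes "monoid K" "rational (free_monoid A \<times>\<times> K) T" "p \<in> Q" "q \<in> Q"
  shows "rational (M \<times>\<times> K) (through p T q)"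
proof -
  interpret AK: monoid "free_monoid A \<times>\<times> K" by (intro DirProd_monoid monoid_free_monoid assms(1))
  have MK: "monoid (M \<times>\<times> K)" by (intro DirProd_monoid M.monoid_axioms assms(1))
  show ?thesis
    using assms(2-4)
  proof (induction arbitrary: p q rule: AK.rational_mon_induct)
    case (finite S)
    have "through p S q = (\<Union>(u, v)\<in>S. through p {(u, v)} q)" by (auto simp: through_def)
    then show ?case using finite by (auto intro!: rational_UN rational_through_word assms(1))
  next
    case (union S T)
    have "through p (S \<union> T) q = through p S q \<union> through p T q" by (auto simp: through_def)
    then show ?case using union by (simp add: rational.union)
  next
    case (product S T)
    then show ?case
      using finite_states by (auto simp: through_product intro!: rational_UN rational.product)
  next
    case (star S)
    \<comment> \<open>\<open>?E\<close> may be infinite, but its label sets are rational by the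
      induction hypothesis, as \<open>rational_path\<close> demands.\<close>
    let ?E = "{(r, x, s). r \<in> Q \<and> s \<in> Q \<and> x \<in> through r S s}"
    have E: "?E \<subseteq> Q \<times> carrier (M \<times>\<times> K) \<times> Q"
      using star(1) run_closed(1) by (fastforce simp: through_def)
    have "rational (M \<times>\<times> K) {x. (r, x, s) \<in> ?E}" if "r \<in> Q" "s \<in> Q" for r s
      using that star.IH by simp
    then have "rational (M \<times>\<times> K) {x. path (M \<times>\<times> K) ?E p x r}" for r
      by (rule monoid.rational_path[OF MK finite_states E])
    then show ?case
      unfolding through_star[OF assms(1) star.prems star.hyps]
      by (intro rational_UN finite_states rational.product rational_silent assms(1))
  qed
qed

end

text \<open>An automaton for \<open>\<rho>\<close> turns the composite into a finite union of sets
  \<open>through i \<tau> f\<close> over initial states \<open>i\<close> and final states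
  \<open>f\<close>. The middle alphabet \<open>A\<close> may be infinite, which allows the tagged
  letters below.\<close>

theorem rational_relcomp:
  assumes "monoid M" "monoid K"
    and "rational (M \<times>\<times> free_monoid A) \<rho>" "rational (free_monoid A \<times>\<times> K) \<tau>"
  shows "rational (M \<times>\<times> K) (\<rho> O \<tau>)"
proof -
  interpret M: monoid M by fact
  let ?N = "M \<times>\<times> free_monoid A"
  interpret N: monoid ?N by (intro DirProd_monoid monoid_free_monoid assms(1))
  have "recognizable ?N (letter_labels M A) \<rho>"
    by (intro N.rational_imp_recognizable assms letter_labels_generate)
      (auto simp: letter_labels_def)
  then obtain E :: "(bool list \<times> _ \<times> bool list) set" and I F where
    E: "finite E" "finite I" "finite F" "E \<subseteq> UNIV \<times> letter_labels M A \<times> UNIV"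
      "\<rho> = {n. \<exists>i\<in>I. \<exists>f\<in>F. path ?N E i n f}"
    unfolding recognizable_def by blast
  define Q where "Q = fst ` E \<union> (snd \<circ> snd) ` E \<union> I \<union> F"
  interpret letter_automaton M A E Q
  proof
    show "E \<subseteq> Q \<times> letter_labels M A \<times> Q"
      using E(4) by (force simp: Q_def)
  qed (use E in \<open>auto simp: Q_def\<close>)
  have "\<rho> O \<tau> = (\<Union>i\<in>I. \<Union>f\<in>F. through i \<tau> f)"
    unfolding E(5) by (auto simp: through_def)
  also have "rational (M \<times>\<times> K) \<dots>"
    using E by (intro rational_UN rational_through assms) (auto simp: Q_def)
  finally show ?thesis .
qed


section \<open>Families of languages\<close>

text \<open>The inclusion is a homomorphism; this serves to enlarge alphabets.\<close>

lemma rational_submonoid: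
  assumes "monoid N" "monoid N'" "carrier N \<subseteq> carrier N'" "mult N = mult N'" "one N = one N'"
    and "rational N S"
  shows "rational N' S"
  using rational_image[of N N' id S] assms by (auto simp: hom_def Pi_iff)

lemma rational_range_free:
  assumes "monoid M" "A \<subseteq> B" "rational (M \<times>\<times> free_monoid A) \<rho>"
  shows "rational (M \<times>\<times> free_monoid B) \<rho>"
  by (rule rational_submonoid[OF DirProd_monoid DirProd_monoid _ _ _ assms(3)])
    (use assms monoid_free_monoid in \<open>auto simp: DirProd_def free_monoid_def\<close>)

lemma rational_domain_free:
  assumes "monoid M" "A \<subseteq> B" "rational (free_monoid A \<times>\<times> M) \<rho>"
  shows "rational (free_monoid B \<times>\<times> M) \<rho>"
  by (rule rational_submonoid[OF DirProd_monoid DirProd_monoid _ _ _ assms(3)])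
    (use assms monoid_free_monoid in \<open>auto simp: DirProd_def free_monoid_def\<close>)

lemma rational_lists:
  assumes "finite A"
  shows "rational (free_monoid A) (lists A)"
proof -
  interpret monoid "free_monoid A" by (rule monoid_free_monoid)
  let ?S = "(\<lambda>a. [a]) ` A"
  have S: "?S \<subseteq> carrier (free_monoid A)" by auto
  have "w \<in> mon_star (free_monoid A) ?S" if "w \<in> lists A" for w
    using that
  proof (induction w)
    case Nil
    then show ?case using mon_star.one[of "free_monoid A" ?S] by simp
  next
    case (Cons a w)
    then show ?case using mon_star.mult[of "[a]" ?S w "free_monoid A"] by auto
  qed
  then have "lists A = mon_star (free_monoid A) ?S"
    using mon_star_closed[OF _ S] by auto
  moreover have "rational (free_monoid A) ?S" using assms S by (intro rational.finite) auto
  ultimately show ?thesis using rational_star by metis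
qed

text \<open>A nonempty word is a letter followed by any word. This set will keep the untagged empty
  word out of the domain of a relation.\<close>

lemma rational_nonempty_words:
  assumes "finite A"
  shows "rational (free_monoid A) (lists A - {[]})"
proof -
  have "lists A - {[]} = (\<lambda>a. [a]) ` A <#>\<^bsub>free_monoid A\<^esub> lists A"
  proof (intro equalityI subsetI)
    fix w assume "w \<in> lists A - {[]}"
    then obtain a u where "w = a # u" "a \<in> A" "u \<in> lists A" by (cases w) auto
    then show "w \<in> (\<lambda>a. [a]) ` A <#>\<^bsub>free_monoid A\<^esub> lists A" by (auto simp: mem_set_mult)
  qed (auto simp: mem_set_mult)
  moreover have "rational (free_monoid A) ((\<lambda>a. [a]) ` A)"
    using assms by (intro rational.finite) auto
  ultimately show ?thesis using rational_lists[OF assms] by (simp add: rational.product)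
qed

text \<open>Pairing a word with its letterwise image, in either order, is a homomorphism into the
  product. Such relations attach and remove tags.\<close>

lemma rational_relation_map:
  assumes "rational (free_monoid A) S" "f ` A \<subseteq> B"
  shows "rational (free_monoid A \<times>\<times> free_monoid B) ((\<lambda>w. (w, map f w)) ` S)"
    and "rational (free_monoid B \<times>\<times> free_monoid A) ((\<lambda>w. (map f w, w)) ` S)"
proof -
  note m = monoid_free_monoid DirProd_monoid[OF monoid_free_monoid monoid_free_monoid]
  show "rational (free_monoid A \<times>\<times> free_monoid B) ((\<lambda>w. (w, map f w)) ` S)"
    by (rule rational_image[OF m _ _ assms(1)]) (use assms(2) in \<open>auto simp: hom_def image_subset_iff\<close>)
  show "rational (free_monoid B \<times>\<times> free_monoid A) ((\<lambda>w. (map f w, w)) ` S)"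
    by (rule rational_image[OF m _ _ assms(1)]) (use assms(2) in \<open>auto simp: hom_def image_subset_iff\<close>)
qed

text \<open>Finite sets involve finitely many letters, union and product merge two finite alphabets,
  and the star adds no letter. For infinite \<open>B\<close> this is what bounds the number of tags
  a relation can see.\<close>

lemma rational_finitely_many_letters:
  assumes "monoid K" "rational (free_monoid B \<times>\<times> K) \<rho>"
  obtains A where "finite A" "fst ` \<rho> \<subseteq> lists A"
proof -
  interpret monoid "free_monoid B \<times>\<times> K" by (intro DirProd_monoid monoid_free_monoid assms(1))
  have "\<exists>A. finite A \<and> fst ` \<rho> \<subseteq> lists A"
    using assms(2)
  proof (induction rule: rational_mon_induct)
    case (finite S)
    then show ?case by (intro exI[of _ "\<Union>x\<in>S. set (fst x)"]) auto
  next
    case (union S T)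
    then obtain A A' where "finite A" "fst ` S \<subseteq> lists A" "finite A'" "fst ` T \<subseteq> lists A'" by auto
    then show ?case by (intro exI[of _ "A \<union> A'"]) (auto simp: lists_eq_set)
  next
    case (product S T)
    then obtain A A' where "finite A" "fst ` S \<subseteq> lists A" "finite A'" "fst ` T \<subseteq> lists A'" by auto
    then show ?case by (intro exI[of _ "A \<union> A'"]) (fastforce simp: lists_eq_set mem_set_mult)
  next
    case (star S)
    then obtain A where A: "finite A" "fst ` S \<subseteq> lists A" by auto
    have "fst x \<in> lists A" if "x \<in> mon_star (free_monoid B \<times>\<times> K) S" for x
      using that by induction (use A in auto)
    then show ?case using A(1) by (intro exI[of _ A]) auto
  qed
  then show ?thesis using that by blast
qed

section \<open>Closure properties of the family of a monoid\<close>

lemma language_familyI: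
  "alphabet \<Sigma> \<Longrightarrow> rational (M \<times>\<times> free_monoid \<Sigma>) \<rho> \<Longrightarrow> \<rho> `` X \<in> language_family M X"
  unfolding language_family_def rational_relation_def by blast

lemma language_familyE:
  assumes "L \<in> language_family M X"
  obtains \<rho> \<Sigma> where "alphabet \<Sigma>" "rational (M \<times>\<times> free_monoid \<Sigma>) \<rho>" "L = \<rho> `` X"
  using assms unfolding language_family_def rational_relation_def by blast

text \<open>The relation \<open>{x} \<times> L\<close> maps \<open>X\<close> onto \<open>L\<close>.
  It is the product of \<open>{(x, [])}\<close> with the image of \<open>L\<close> under the
  embedding of words with unit first component.\<close>

lemma rational_language_in_family:
  assumes "monoid M" "x \<in> X" "x \<in> carrier M" "rational_language L"
  shows "L \<in> language_family M X"
proof -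
  interpret M: monoid M by fact
  from assms(4) obtain \<Sigma> where \<Sigma>: "alphabet \<Sigma>" "rational (free_monoid \<Sigma>) L"
    unfolding rational_language_def by blast
  let ?N = "M \<times>\<times> free_monoid \<Sigma>"
  have "rational ?N (Pair \<one>\<^bsub>M\<^esub> ` L)"
    by (rule rational_image[OF monoid_free_monoid DirProd_monoid[OF assms(1) monoid_free_monoid] _ _ \<Sigma>(2)])
      (auto simp: hom_def)
  moreover have "rational ?N {(x, [])}" using assms(3) by (simp add: rational.finite)
  ultimately have "rational ?N ({(x, [])} <#>\<^bsub>?N\<^esub> Pair \<one>\<^bsub>M\<^esub> ` L)" by (simp add: rational.product)
  then have "({(x, [])} <#>\<^bsub>?N\<^esub> Pair \<one>\<^bsub>M\<^esub> ` L) `` X \<in> language_family M X"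
    by (rule language_familyI[OF \<Sigma>(1)])
  moreover have "({(x, [])} <#>\<^bsub>?N\<^esub> Pair \<one>\<^bsub>M\<^esub> ` L) `` X = L"
    using assms(2,3) by (auto simp: mem_set_mult)
  ultimately show ?thesis by simp
qed

lemma family_closed_under_transduction:
  assumes "monoid M"
  shows "closed_under_rational_transduction (language_family M X :: 'a list set set)"
  unfolding closed_under_rational_transduction_def rational_relation_def
proof (intro allI impI, elim conjE)
  fix \<Sigma> \<Delta> :: "'a set" and L :: "'a list set" and \<tau>
  assume \<Delta>: "alphabet \<Delta>" and L: "L \<in> language_family M X"
    and \<tau>: "rational (free_monoid \<Sigma> \<times>\<times> free_monoid \<Delta>) \<tau>"
  from L obtain \<rho> \<Gamma> where \<rho>: "rational (M \<times>\<times> free_monoid \<Gamma>) \<rho>" "L = \<rho> `` X"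
    by (rule language_familyE)
  \<comment> \<open>The alphabets \<open>\<Gamma>\<close> and \<open>\<Sigma>\<close> may differ, so
    both relations are moved to the free monoid on all letters before composing.\<close>
  have "rational (M \<times>\<times> free_monoid \<Delta>) (\<rho> O \<tau>)"
    using rational_relcomp[OF assms monoid_free_monoid
        rational_range_free[OF assms subset_UNIV \<rho>(1)]
        rational_domain_free[OF monoid_free_monoid subset_UNIV \<tau>]] .
  then have "(\<rho> O \<tau>) `` X \<in> language_family M X"
    by (rule language_familyI[OF \<Delta>])
  then show "\<tau> `` L \<in> language_family M X"
    by (simp add: \<rho>(2) relcomp_Image)
qed

text \<open>The image under a union of relations is the union of the images; since the target
  alphabets may differ, both relations are first extended to
  \<open>\<Gamma> \<union> \<Gamma>'\<close>.\<close>

lemma family_closed_under_union: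
  assumes "monoid M"
  shows "closed_under_union (language_family M X :: 'a list set set)"
  unfolding closed_under_union_def
proof (intro allI impI, elim conjE)
  fix L L' :: "'a list set"
  assume "L \<in> language_family M X" "L' \<in> language_family M X"
  then obtain \<rho> \<Gamma> \<rho>' \<Gamma>' where *: "alphabet \<Gamma>" "rational (M \<times>\<times> free_monoid \<Gamma>) \<rho>" "L = \<rho> `` X"
      "alphabet \<Gamma>'" "rational (M \<times>\<times> free_monoid \<Gamma>') \<rho>'" "L' = \<rho>' `` X"
    by (elim language_familyE)
  have "rational (M \<times>\<times> free_monoid (\<Gamma> \<union> \<Gamma>')) (\<rho> \<union> \<rho>')"
    using rational_range_free[OF assms _ *(2)] rational_range_free[OF assms _ *(5)]
    by (intro rational.union) simp_all
  moreover have "alphabet (\<Gamma> \<union> \<Gamma>')" using * by (simp add: alphabet_def)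
  ultimately have "(\<rho> \<union> \<rho>') `` X \<in> language_family M X" by (intro language_familyI)
  then show "L \<union> L' \<in> language_family M X" by (simp add: * Un_Image)
qed

text \<open>The union is disjoint except that the empty word carries no tag; this is why the
  empty word is treated separately below.\<close>

definition tagged_union :: "'a list set set \<Rightarrow> ('a list set \<times> 'a) list set" where
  "tagged_union C = (\<Union>L\<in>C. map (Pair L) ` L)"

section \<open>Realizing a closed collection as a family\<close>

locale closed_collection =
  fixes C :: "'a list set set"
  assumes collection: "collection_of_languages C"
    and nonempty: "\<exists>L\<in>C. L \<noteq> {}"
    and transduction: "closed_under_rational_transduction C"
    and union: "closed_under_union C"
begin

lemma collection_alphabet:
  assumes "L \<in> C"
  obtains \<Sigma> where "alphabet \<Sigma>" "finite \<Sigma>" "L \<subseteq> lists \<Sigma>"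
  using assms collection
  unfolding collection_of_languages_def language_over_def alphabet_def free_monoid_simps by blast

lemma transductionI:
  assumes "alphabet \<Sigma>" "alphabet \<Delta>" "L \<in> C" "L \<subseteq> lists \<Sigma>"
    and "rational (free_monoid \<Sigma> \<times>\<times> free_monoid \<Delta>) \<tau>"
  shows "\<tau> `` L \<in> C"
  using transduction[unfolded closed_under_rational_transduction_def language_over_def
      rational_relation_def, rule_format, of \<Sigma> \<Delta> L \<tau>] assms
  by simp

text \<open>Binary unions are iterated; the empty union is the image of some member under the empty
  relation.\<close>

lemma finite_Union_in_collection:
  assumes "alphabet \<Delta>" "finite F" "F \<subseteq> C" "\<And>L. L \<in> F \<Longrightarrow> L \<subseteq> lists \<Delta>"
  shows "\<Union>F \<in> C"
  using assms(2-4)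
proof (induction rule: finite_induct)
  case empty
  obtain L where L: "L \<in> C" using nonempty by blast
  then obtain \<Sigma> where "alphabet \<Sigma>" "finite \<Sigma>" "L \<subseteq> lists \<Sigma>" by (rule collection_alphabet)
  then have "{} `` L \<in> C"
    using L assms(1) by (intro transductionI[of \<Sigma> \<Delta>]) (auto intro: rational.finite)
  then show ?case by simp
next
  case (insert L F)
  then have "L \<in> C" "\<Union>F \<in> C" "L \<subseteq> lists \<Delta>" "\<Union>F \<subseteq> lists \<Delta>" by auto
  then have "L \<union> \<Union>F \<in> C"
    using union assms(1) unfolding closed_under_union_def language_over_def
    by (metis free_monoid_simps(1))
  then show ?case by simp
qed

text \<open>The relation that accepts only words tagged with \<open>L\<close> and removes the tags
  recovers \<open>L\<close> from the tagged union.\<close>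

lemma collection_subset_family: "C \<subseteq> language_family (free_monoid UNIV) (tagged_union C)"
proof
  fix L assume L: "L \<in> C"
  then obtain \<Sigma> where \<Sigma>: "alphabet \<Sigma>" "finite \<Sigma>" "L \<subseteq> lists \<Sigma>" by (rule collection_alphabet)
  define S where "S = (if [] \<in> L then lists \<Sigma> else lists \<Sigma> - {[]})"
  let ?\<rho> = "(\<lambda>w. (map (Pair L) w, w)) ` S"
  have "rational (free_monoid \<Sigma>) S"
    unfolding S_def using rational_lists rational_nonempty_words \<Sigma>(2) by auto
  then have "rational (free_monoid UNIV \<times>\<times> free_monoid \<Sigma>) ?\<rho>"
    by (rule rational_relation_map) simp
  then have "?\<rho> `` tagged_union C \<in> language_family (free_monoid UNIV) (tagged_union C)"
    by (rule language_familyI[OF \<Sigma>(1)])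
  moreover have "?\<rho> `` tagged_union C = L"
  proof (intro equalityI subsetI)
    fix w assume "w \<in> ?\<rho> `` tagged_union C"
    then obtain L' w' where w: "w \<in> S" "L' \<in> C" "w' \<in> L'" "map (Pair L') w' = map (Pair L) w"
      by (auto simp: tagged_union_def)
    have "w' = w"
      using arg_cong[OF w(4), of "map snd"] by (simp add: comp_def)
    show "w \<in> L"
    proof (cases w)
      case Nil
      then show ?thesis using w(1) by (auto simp: S_def split: if_splits)
    next
      \<comment> \<open>A nonempty word shows its tag, which forces \<open>L' = L\<close>.\<close>
      case (Cons a v)
      then show ?thesis using w \<open>w' = w\<close> by simp
    qed
  next
    fix w assume "w \<in> L"
    then have "w \<in> S" using \<Sigma>(3) by (auto simp: S_def)
    then show "w \<in> ?\<rho> `` tagged_union C"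
      using L \<open>w \<in> L\<close> by (auto simp: tagged_union_def)
  qed
  ultimately show "L \<in> language_family (free_monoid UNIV) (tagged_union C)" by simp
qed

text \<open>Only finitely many tags occur in \<open>\<rho>\<close>, so the image is a finite union
  of images of members of \<open>C\<close>, each obtained by attaching a tag and applying
  \<open>\<rho>\<close>.\<close>

lemma family_subset_collection: "language_family (free_monoid UNIV) (tagged_union C) \<subseteq> C"
proof
  fix L' :: "'a list set"
  assume "L' \<in> language_family (free_monoid UNIV) (tagged_union C)"
  then obtain \<rho> \<Delta> where \<Delta>: "alphabet \<Delta>" and L': "L' = \<rho> `` tagged_union C"
    and \<rho>: "rational ((free_monoid UNIV :: ('a list set \<times> 'a) list monoid) \<times>\<times> free_monoid \<Delta>) \<rho>"
    by (rule language_familyE)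
  interpret U: monoid "(free_monoid UNIV :: ('a list set \<times> 'a) list monoid) \<times>\<times> free_monoid \<Delta>"
    by (intro DirProd_monoid monoid_free_monoid)
  obtain A where A: "finite A" "fst ` \<rho> \<subseteq> lists A"
    using rational_finitely_many_letters[OF monoid_free_monoid \<rho>] .
  \<comment> \<open>\<open>E\<close> represents all members that contain the empty word: that word
    has no tag, so \<open>A\<close> does not reveal where it came from.\<close>
  obtain E where E: "E \<in> C" "(\<exists>L\<in>C. [] \<in> L) \<longrightarrow> [] \<in> E" using nonempty by blast
  \<comment> \<open>The intersection discards tags in \<open>A\<close> that are not members of
    \<open>C\<close>.\<close>
  define C0 where "C0 = C \<inter> insert E (fst ` A)"
  have "L' = \<Union> ((\<lambda>L. \<rho> `` (map (Pair L) ` L)) ` C0)"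
  proof (intro equalityI subsetI)
    fix v assume "v \<in> L'"
    then obtain L w where w: "L \<in> C" "w \<in> L" "(map (Pair L) w, v) \<in> \<rho>"
      by (auto simp: L' tagged_union_def)
    show "v \<in> \<Union> ((\<lambda>L. \<rho> `` (map (Pair L) ` L)) ` C0)"
    proof (cases w)
      case Nil
      then have "E \<in> C0" "[] \<in> E" using E w by (auto simp: C0_def)
      then show ?thesis using w(3) Nil by force
    next
      case (Cons a u)
      then have "(L, a) \<in> A" using w(3) A(2) by force
      then have "L \<in> C0" using w(1) by (force simp: C0_def)
      then show ?thesis using w by blast
    qed
  next
    fix v assume "v \<in> \<Union> ((\<lambda>L. \<rho> `` (map (Pair L) ` L)) ` C0)"
    then show "v \<in> L'" by (auto simp: L' tagged_union_def C0_def)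
  qed
  moreover have "\<Union> ((\<lambda>L. \<rho> `` (map (Pair L) ` L)) ` C0) \<in> C"
  proof (rule finite_Union_in_collection[OF \<Delta>])
    show "finite ((\<lambda>L. \<rho> `` (map (Pair L) ` L)) ` C0)" using A(1) by (simp add: C0_def)
    show "(\<lambda>L. \<rho> `` (map (Pair L) ` L)) ` C0 \<subseteq> C"
    proof (intro image_subsetI)
      fix L assume "L \<in> C0"
      then have L: "L \<in> C" by (simp add: C0_def)
      then obtain \<Sigma> where \<Sigma>: "alphabet \<Sigma>" "finite \<Sigma>" "L \<subseteq> lists \<Sigma>" by (rule collection_alphabet)
      \<comment> \<open>Tagging passes through an infinite alphabet, but the composite with
        \<open>\<rho>\<close> is a transduction between the alphabets \<open>\<Sigma>\<close> and
        \<open>\<Delta>\<close>.\<close>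
      let ?\<tau> = "(\<lambda>w. (w, map (Pair L) w)) ` lists \<Sigma> O \<rho>"
      have "rational (free_monoid \<Sigma> \<times>\<times> free_monoid UNIV) ((\<lambda>w. (w, map (Pair L) w)) ` lists \<Sigma>)"
        by (rule rational_relation_map[OF rational_lists[OF \<Sigma>(2)]]) simp
      from rational_relcomp[OF monoid_free_monoid monoid_free_monoid this \<rho>]
      have "?\<tau> `` L \<in> C"
        by (rule transductionI[OF \<Sigma>(1) \<Delta> L \<Sigma>(3)])
      moreover have "((\<lambda>w. (w, map (Pair L) w)) ` lists \<Sigma>) `` L = map (Pair L) ` L"
        using \<Sigma>(3) by (auto simp: Image_iff image_iff Bex_def)
      then have "?\<tau> `` L = \<rho> `` (map (Pair L) ` L)" by (simp add: relcomp_Image)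
      ultimately show "\<rho> `` (map (Pair L) ` L) \<in> C" by simp
    qed
    show "V \<subseteq> lists \<Delta>" if "V \<in> (\<lambda>L. \<rho> `` (map (Pair L) ` L)) ` C0" for V
      using that U.rational_carrier[OF \<rho>] by fastforce
  qed
  ultimately show "L' \<in> C" by simp
qed

end

text \<open>In the converse each member of \<open>C\<close> is its own tag, which makes distinct
  members have distinct tags and fixes the letters as pairs of a language and a letter. The free
  monoid on all such pairs serves every \<open>C\<close>; only \<open>X\<close> varies.\<close>

theorem theorem6p2:
  shows "(\<forall>(M :: ('m, 'e) monoid_scheme) X. monoid M \<and> X \<subseteq> carrier M \<and> X \<noteq> {} \<longrightarrow>
            (\<forall>L. rational_language L \<longrightarrow> L \<in> (language_family M X :: 'a list set set)) \<and>
            closed_under_rational_transduction (language_family M X :: 'a list set set) \<and>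
            closed_under_union (language_family M X :: 'a list set set)) \<and>
         (\<forall>C :: 'a list set set. collection_of_languages C \<and> (\<exists>L\<in>C. L \<noteq> {}) \<and>
            closed_under_rational_transduction C \<and> closed_under_union C \<longrightarrow>
            (\<exists>(M :: ('a list set \<times> 'a) list monoid) X.
               monoid M \<and> X \<subseteq> carrier M \<and> X \<noteq> {} \<and> C = language_family M X))"
proof (intro conjI allI impI; elim conjE)
  fix M :: "('m, 'e) monoid_scheme" and X
  assume M: "monoid M" "X \<subseteq> carrier M" "X \<noteq> {}"
  show "L \<in> (language_family M X :: 'a list set set)" if "rational_language L" for L
  proof -
    obtain x where "x \<in> X" "x \<in> carrier M" using M(2,3) by auto
    from rational_language_in_family[OF M(1) this that] show ?thesis .
  qed
  show "closed_under_rational_transduction (language_family M X :: 'a list set set)"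
    by (rule family_closed_under_transduction[OF M(1)])
  show "closed_under_union (language_family M X :: 'a list set set)"
    by (rule family_closed_under_union[OF M(1)])
next
  fix C :: "'a list set set"
  assume "collection_of_languages C" "\<exists>L\<in>C. L \<noteq> {}"
    "closed_under_rational_transduction C" "closed_under_union C"
  then interpret closed_collection C by unfold_locales
  have "tagged_union C \<noteq> {}" using nonempty by (auto simp: tagged_union_def)
  moreover have "C = language_family (free_monoid UNIV) (tagged_union C)"
    using collection_subset_family family_subset_collection by (rule equalityI)
  moreover have "monoid (free_monoid UNIV :: ('a list set \<times> 'a) list monoid)"
    by (rule monoid_free_monoid)
  ultimately show "\<exists>(M :: ('a list set \<times> 'a) list monoid) X.
      monoid M \<and> X \<subseteq> carrier M \<and> X \<noteq> {} \<and> C = language_family M X"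
    by (intro exI[of _ "free_monoid UNIV"] exI[of _ "tagged_union C"]) simp
qed

end
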